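(* Let $X$ be a random variable with variance $\sigma^2$ taking a finite number $n$ of (distinct) values with (positive) probabilities $p_1, p_2, \ldots, p_n$ respectively. Let $\tau>0$ and let $Z_\tau$ be a normal random variable with mean zero and variance $\tau$, independent of $X$. Then $Y_\tau = X + Z_\tau$ satisfies a Poincaré inequality with constant $$\tau \left(1 + \left( \frac{\sigma^2}{\tau \min_s p_s} \right) \exp \left( \frac{\sigma^2}{\tau \min_s p_s} \right) \right),$$ that is, $$R_{Y_\tau} \le \tau \left(1 + \left( \frac{\sigma^2}{\tau \min_s p_s} \right) \exp \left( \frac{\sigma^2}{\tau \min_s p_s} \right) \right).$$
   Context: For a real random variable $Y$, the Poincaré constant is $$R_Y = \sup_{g \in H_1(Y)} \frac{\mathrm{Var}\, g(Y)}{\mathbb{E}\, g'(Y)^2},$$ where $H_1(Y)$ is the space of absolutely continuous functions $g$ on the real line such that $\mathrm{Var}\, g(Y) > 0$ and $\mathbb{E}\, g'(Y)^2 < \infty$. The constant $R_Y$ may be infinite. *)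

theory Defs
  imports "HOL-Probability.Probability"
begin

definition abs_continuous_fun_on :: "real set \<Rightarrow> (real \<Rightarrow> real) \<Rightarrow> bool" where
  "abs_continuous_fun_on S f \<longleftrightarrow>
    (\<forall>\<epsilon>>0. \<exists>\<delta>>0. \<forall>(I :: nat set) a b.
       finite I \<longrightarrow>
       (\<forall>i\<in>I. a i \<le> b i \<and> {a i..b i} \<subseteq> S) \<longrightarrow>
       disjoint_family_on (\<lambda>i. {a i<..<b i}) I \<longrightarrow>
       (\<Sum>i\<in>I. b i - a i) < \<delta> \<longrightarrow>
       (\<Sum>i\<in>I. \<bar>f (b i) - f (a i)\<bar>) < \<epsilon>)"

text \<open>Absolute continuity on the real line is understood in the usual local sense
  (on every compact interval); the uniform notion on the whole line would exclude functions
  such as the square.\<close>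

definition abs_continuous_fun :: "(real \<Rightarrow> real) \<Rightarrow> bool" where
  "abs_continuous_fun f \<longleftrightarrow> (\<forall>u v. abs_continuous_fun_on {u..v} f)"

text \<open>The variance with values in $[0,\infty]$. The Bochner integral of a non-integrable
  function is 0, so the real-valued variance would be wrong for random variables without
  second moment.\<close>

definition ext_variance :: "'a measure \<Rightarrow> ('a \<Rightarrow> real) \<Rightarrow> ennreal" where
  "ext_variance M U =
    (if integrable M U
     then \<integral>\<^sup>+ \<omega>. ennreal ((U \<omega> - (\<integral>\<omega>. U \<omega> \<partial>M))\<^sup>2) \<partial>M
     else \<infinity>)"

text \<open>The mean square of \<open>g'(Y)\<close>. An absolutely continuous \<open>g\<close> is differentiable Lebesgue-almost
  everywhere; at the remaining points \<^term>\<open>deriv g\<close> has some fixed unspecified value, which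
  is irrelevant whenever the law of \<open>Y\<close> has a density.\<close>

definition energy :: "'a measure \<Rightarrow> ('a \<Rightarrow> real) \<Rightarrow> (real \<Rightarrow> real) \<Rightarrow> ennreal" where
  "energy M Y g = (\<integral>\<^sup>+ \<omega>. ennreal ((deriv g (Y \<omega>))\<^sup>2) \<partial>M)"

definition H1 :: "'a measure \<Rightarrow> ('a \<Rightarrow> real) \<Rightarrow> (real \<Rightarrow> real) set" where
  "H1 M Y = {g. abs_continuous_fun g \<and>
                ext_variance M (\<lambda>\<omega>. g (Y \<omega>)) > 0 \<and> energy M Y g < \<infinity>}"

text \<open>In \<^typ>\<open>ennreal\<close> a positive number divided by 0 is \<open>\<infinity>\<close>, and \<open>\<infinity>\<close> divided by a finite
  number is \<open>\<infinity>\<close>; the form \<open>0/0\<close> does not occur on \<^const>\<open>H1\<close>.\<close>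

definition poincare_constant :: "'a measure \<Rightarrow> ('a \<Rightarrow> real) \<Rightarrow> ennreal" where
  "poincare_constant M Y =
    (SUP g\<in>H1 M Y. ext_variance M (\<lambda>\<omega>. g (Y \<omega>)) / energy M Y g)"

end

theory Submission
  imports Defs
begin

text \<open>If \<open>Y\<close> has density \<open>f\<close> and mean \<open>\<mu>\<close>, then writing the variance as
  \<open>Var g(Y) = 1/2 E (g(Y) - g(Y'))\<^sup>2\<close> with an independent copy \<open>Y'\<close>, bounding the increment of
  \<open>g\<close> by the Cauchy-Schwarz inequality and exchanging the integrals gives
  \<open>Var g(Y) \<le> \<integral> g'(s)\<^sup>2 \<kappa>(s) ds\<close>, where
  \<open>\<kappa>(s) = E (Y - Y') 1(Y' < s \<le> Y) = E (Y - \<mu>) 1(Y \<ge> s)\<close>.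
  Hence the Poincare constant is at most \<open>sup \<kappa>/f\<close>. For the normal mixture,
  \<open>\<kappa>(s) = \<tau> f(s) + \<Sum>\<^sub>i p\<^sub>i (x\<^sub>i - \<mu>) Q(s - x\<^sub>i)\<close> with the normal tail \<open>Q\<close>. The sum is
  half of \<open>\<Sum>\<^sub>i\<^sub>j p\<^sub>i p\<^sub>j (x\<^sub>i - x\<^sub>j) (Q(s - x\<^sub>i) - Q(s - x\<^sub>j))\<close>, and the trapezoidal rule
  bounds each difference of tails by the average of the normal densities at its end points, up to
  the factor \<open>exp ((x\<^sub>i - x\<^sub>j)\<^sup>2 / (8 \<tau>))\<close>; finally
  \<open>(x\<^sub>i - x\<^sub>j)\<^sup>2 \<le> 2 \<sigma>\<^sup>2 / min p\<close>.

  All of this needs that a locally absolutely continuous \<open>g\<close> is differentiable almost everywhere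
  with increments bounded by the integral of \<open>|g'|\<close>. Here \<open>g\<close> is, on each compact interval, the
  difference of two monotone absolutely continuous functions; the associated Stieltjes measures have
  densities by the Radon-Nikodym theorem, and these are derivatives almost everywhere by the
  Lebesgue differentiation theorem.\<close>

section \<open>Absolutely continuous functions\<close>

text \<open>The definition speaks of index sets of natural numbers only. A finite index set of any
  type injects into \<open>nat\<close>, so families indexed by \<open>unit\<close>, by pairs or by
  the intervals themselves can be used later.\<close>

lemma abs_continuous_fun_onE:
  assumes "abs_continuous_fun_on S f" "\<epsilon> > 0"
  obtains \<delta> where "\<delta> > 0"
    "\<And>(I :: 'i set) a b. finite I \<Longrightarrow> (\<And>i. i \<in> I \<Longrightarrow> a i \<le> b i \<and> {a i..b i} \<subseteq> S) \<Longrightarrow>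
      disjoint_family_on (\<lambda>i. {a i<..<b i}) I \<Longrightarrow> (\<Sum>i\<in>I. b i - a i) < \<delta> \<Longrightarrow>
      (\<Sum>i\<in>I. \<bar>f (b i) - f (a i)\<bar>) < \<epsilon>"
proof -
  obtain \<delta> where "\<delta> > 0" and \<delta>: "\<forall>(I :: nat set) a b. finite I \<longrightarrow>
      (\<forall>i\<in>I. a i \<le> b i \<and> {a i..b i} \<subseteq> S) \<longrightarrow>
      disjoint_family_on (\<lambda>i. {a i<..<b i}) I \<longrightarrow> (\<Sum>i\<in>I. b i - a i) < \<delta> \<longrightarrow>
      (\<Sum>i\<in>I. \<bar>f (b i) - f (a i)\<bar>) < \<epsilon>"
    using assms unfolding abs_continuous_fun_on_def by blast
  show thesis
  proof (rule that[OF \<open>\<delta> > 0\<close>])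
    fix I :: "'i set" and a b
    assume I: "finite I" "\<And>i. i \<in> I \<Longrightarrow> a i \<le> b i \<and> {a i..b i} \<subseteq> S"
      "disjoint_family_on (\<lambda>i. {a i<..<b i}) I" "(\<Sum>i\<in>I. b i - a i) < \<delta>"
    obtain e :: "'i \<Rightarrow> nat" where e: "inj_on e I"
      using finite_imp_inj_to_nat_seg[OF \<open>finite I\<close>] by blast
    define r where "r = the_inv_into I e"
    have r: "r (e i) = i" if "i \<in> I" for i
      unfolding r_def using e that by (rule the_inv_into_f_f)
    have "(\<Sum>j\<in>e ` I. \<bar>f (b (r j)) - f (a (r j))\<bar>) < \<epsilon>"
    proof (rule \<delta>[THEN spec, THEN spec, THEN spec, THEN mp, THEN mp, THEN mp, THEN mp])
      show "disjoint_family_on (\<lambda>j. {a (r j)<..<b (r j)}) (e ` I)"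
        using I(3) unfolding disjoint_family_on_def by (auto simp: r)
      show "(\<Sum>j\<in>e ` I. b (r j) - a (r j)) < \<delta>"
        using I(4) by (subst sum.reindex[OF e]) (simp add: r)
      show "\<forall>j\<in>e ` I. a (r j) \<le> b (r j) \<and> {a (r j)..b (r j)} \<subseteq> S"
        unfolding ball_simps using I(2) r by simp
    qed (use I(1) in simp)
    then show "(\<Sum>i\<in>I. \<bar>f (b i) - f (a i)\<bar>) < \<epsilon>"
      by (subst (asm) sum.reindex[OF e]) (simp add: r)
  qed
qed

lemma abs_continuous_fun_on_diff:
  assumes f: "abs_continuous_fun_on S f" and g: "abs_continuous_fun_on S g"
  shows "abs_continuous_fun_on S (\<lambda>x. f x - g x)"
  unfolding abs_continuous_fun_on_def
proof (intro allI impI)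
  fix \<epsilon> :: real assume "\<epsilon> > 0"
  then have "\<epsilon> / 2 > 0" by simp
  obtain d1 where d1: "d1 > 0"
    "\<And>(I :: nat set) a b. finite I \<Longrightarrow> (\<And>i. i \<in> I \<Longrightarrow> a i \<le> b i \<and> {a i..b i} \<subseteq> S) \<Longrightarrow>
      disjoint_family_on (\<lambda>i. {a i<..<b i}) I \<Longrightarrow> (\<Sum>i\<in>I. b i - a i) < d1 \<Longrightarrow>
      (\<Sum>i\<in>I. \<bar>f (b i) - f (a i)\<bar>) < \<epsilon> / 2"
    using abs_continuous_fun_onE[OF f \<open>\<epsilon> / 2 > 0\<close>, where ?'i = nat] by blast
  obtain d2 where d2: "d2 > 0"
    "\<And>(I :: nat set) a b. finite I \<Longrightarrow> (\<And>i. i \<in> I \<Longrightarrow> a i \<le> b i \<and> {a i..b i} \<subseteq> S) \<Longrightarrow>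
      disjoint_family_on (\<lambda>i. {a i<..<b i}) I \<Longrightarrow> (\<Sum>i\<in>I. b i - a i) < d2 \<Longrightarrow>
      (\<Sum>i\<in>I. \<bar>g (b i) - g (a i)\<bar>) < \<epsilon> / 2"
    using abs_continuous_fun_onE[OF g \<open>\<epsilon> / 2 > 0\<close>, where ?'i = nat] by blast
  show "\<exists>\<delta>>0. \<forall>(I :: nat set) a b. finite I \<longrightarrow> (\<forall>i\<in>I. a i \<le> b i \<and> {a i..b i} \<subseteq> S) \<longrightarrow>
      disjoint_family_on (\<lambda>i. {a i<..<b i}) I \<longrightarrow> (\<Sum>i\<in>I. b i - a i) < \<delta> \<longrightarrow>
      (\<Sum>i\<in>I. \<bar>f (b i) - g (b i) - (f (a i) - g (a i))\<bar>) < \<epsilon>"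
  proof (intro exI[of _ "min d1 d2"] conjI allI impI)
    fix I :: "nat set" and a b
    assume I: "finite I" "\<forall>i\<in>I. a i \<le> b i \<and> {a i..b i} \<subseteq> S"
      "disjoint_family_on (\<lambda>i. {a i<..<b i}) I" "(\<Sum>i\<in>I. b i - a i) < min d1 d2"
    have "(\<Sum>i\<in>I. \<bar>f (b i) - g (b i) - (f (a i) - g (a i))\<bar>)
        \<le> (\<Sum>i\<in>I. \<bar>f (b i) - f (a i)\<bar> + \<bar>g (b i) - g (a i)\<bar>)"
      by (intro sum_mono) auto
    also have "\<dots> < \<epsilon>"
      using d1(2)[of I a b] d2(2)[of I a b] I by (simp add: sum.distrib)
    finally show "(\<Sum>i\<in>I. \<bar>f (b i) - g (b i) - (f (a i) - g (a i))\<bar>) < \<epsilon>" .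
  qed (use d1(1) d2(1) in auto)
qed

text \<open>The family with a single interval; \<open>min\<close> and \<open>max\<close> of the two
  points make the result symmetric in them.\<close>

lemma abs_continuous_imp_dist_less:
  assumes "abs_continuous_fun_on UNIV f" "\<epsilon> > 0"
  obtains \<delta> where "\<delta> > 0" "\<And>x y. \<bar>y - x\<bar> < \<delta> \<Longrightarrow> \<bar>f y - f x\<bar> < \<epsilon>"
proof -
  obtain \<delta> where \<delta>: "\<delta> > 0"
    "\<And>(I :: unit set) a b. finite I \<Longrightarrow> (\<And>i. i \<in> I \<Longrightarrow> a i \<le> b i \<and> {a i..b i} \<subseteq> UNIV) \<Longrightarrow>
      disjoint_family_on (\<lambda>i. {a i<..<b i}) I \<Longrightarrow> (\<Sum>i\<in>I. b i - a i) < \<delta> \<Longrightarrow>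
      (\<Sum>i\<in>I. \<bar>f (b i) - f (a i)\<bar>) < \<epsilon>"
    using abs_continuous_fun_onE[OF assms, where ?'i = unit] by blast
  have "\<bar>f y - f x\<bar> < \<epsilon>" if "\<bar>y - x\<bar> < \<delta>" for x y
    using \<delta>(2)[of "{()}" "\<lambda>_. min x y" "\<lambda>_. max x y"] that
    by (cases "x \<le> y") (auto simp: disjoint_family_on_def)
  then show thesis using \<delta>(1) that by blast
qed

lemma abs_continuous_imp_continuous:
  assumes "abs_continuous_fun_on UNIV f"
  shows "continuous_on UNIV f"
  unfolding continuous_on_iff dist_real_def
proof (intro ballI allI impI)
  fix x \<epsilon> :: real assume "\<epsilon> > 0"
  obtain \<delta> where "\<delta> > 0" "\<And>x y. \<bar>y - x\<bar> < \<delta> \<Longrightarrow> \<bar>f y - f x\<bar> < \<epsilon>"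
    using abs_continuous_imp_dist_less[OF assms \<open>\<epsilon> > 0\<close>] by blast
  then show "\<exists>d>0. \<forall>x'\<in>UNIV. \<bar>x' - x\<bar> < d \<longrightarrow> \<bar>f x' - f x\<bar> < \<epsilon>" by blast
qed

text \<open>The lengths are the Lebesgue measures of disjoint open intervals contained in
  \<open>{c..d}\<close>.\<close>

lemma sum_disjoint_lengths_le:
  fixes a b :: "'i \<Rightarrow> real"
  assumes "finite I" "\<And>i. i \<in> I \<Longrightarrow> a i \<le> b i \<and> c \<le> a i \<and> b i \<le> d" "c \<le> d"
    and "disjoint_family_on (\<lambda>i. {a i<..<b i}) I"
  shows "(\<Sum>i\<in>I. b i - a i) \<le> d - c"
proof -
  have "(\<Sum>i\<in>I. b i - a i) = (\<Sum>i\<in>I. measure lborel {a i<..<b i})"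
    using assms(2) by (intro sum.cong) auto
  also have "\<dots> = measure lborel (\<Union>i\<in>I. {a i<..<b i})"
    using assms by (intro measure_finite_Union[symmetric]) auto
  also have "\<dots> \<le> measure lborel {c..d}"
    using assms(1,2) by (intro measure_mono_fmeasurable) (auto simp: fmeasurable_def emeasure_lborel_Icc_eq, fastforce, fastforce)
  finally show ?thesis using assms(3) by simp
qed

lemma disjoint_family_on_subsets:
  "disjoint_family_on A I \<Longrightarrow> (\<And>i. i \<in> I \<Longrightarrow> B i \<subseteq> A i) \<Longrightarrow> disjoint_family_on B I"
  unfolding disjoint_family_on_def by blast

section \<open>Positive variation and the Jordan decomposition\<close>

text \<open>The increments are signed and intervals may be left out of a family, so the supremum is
  the positive variation of \<open>G\<close> on the half-line up to \<open>x\<close>. The functions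
  to which this is applied are constant near minus infinity; together with absolute continuity this
  keeps the supremum finite.\<close>

definition interval_sums :: "(real \<Rightarrow> real) \<Rightarrow> real \<Rightarrow> real set" where
  "interval_sums G x = {\<Sum>i\<in>I. G (b i) - G (a i) | (I :: nat set) a b. finite I \<and>
     (\<forall>i\<in>I. a i \<le> b i \<and> b i \<le> x) \<and> disjoint_family_on (\<lambda>i. {a i<..<b i}) I}"

definition pos_variation :: "(real \<Rightarrow> real) \<Rightarrow> real \<Rightarrow> real" where
  "pos_variation G x = Sup (interval_sums G x)"

lemma interval_sumsI:
  fixes a b :: "nat \<Rightarrow> real"
  assumes "finite I" "\<And>i. i \<in> I \<Longrightarrow> a i \<le> b i \<and> b i \<le> x"
    "disjoint_family_on (\<lambda>i. {a i<..<b i}) I"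
  shows "(\<Sum>i\<in>I. G (b i) - G (a i)) \<in> interval_sums G x"
  using assms unfolding interval_sums_def by blast

text \<open>The empty family. It provides the nonemptiness that suprema over
  \<open>interval_sums\<close> require.\<close>

lemma zero_in_interval_sums: "0 \<in> interval_sums G x"
  using interval_sumsI[of "{}" undefined undefined x G] by (simp add: disjoint_family_on_def)

text \<open>Cutting every interval of a family at \<open>y\<close>; the identity
  \<open>G (min t y) + G (max t y) = G t + G y\<close> avoids a case distinction.\<close>

lemma interval_sums_split:
  assumes "s \<in> interval_sums G z"
  obtains l and I :: "nat set" and a b where "l \<in> interval_sums G y" "finite I"
    "\<And>i. i \<in> I \<Longrightarrow> a i \<le> b i \<and> y \<le> a i \<and> b i \<le> max y z"
    "disjoint_family_on (\<lambda>i. {a i<..<b i}) I" "s = l + (\<Sum>i\<in>I. G (b i) - G (a i))"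
proof -
  obtain I :: "nat set" and a b where I: "finite I" "\<forall>i\<in>I. a i \<le> b i \<and> b i \<le> z"
    "disjoint_family_on (\<lambda>i. {a i<..<b i}) I" "s = (\<Sum>i\<in>I. G (b i) - G (a i))"
    using assms unfolding interval_sums_def by blast
  define l where "l = (\<Sum>i\<in>I. G (min (b i) y) - G (min (a i) y))"
  show thesis
  proof (rule that)
    show "l \<in> interval_sums G y"
      unfolding l_def using I(1,2)
      by (intro interval_sumsI disjoint_family_on_subsets[OF I(3)]) auto
    show "disjoint_family_on (\<lambda>i. {max (a i) y<..<max (b i) y}) I"
      by (rule disjoint_family_on_subsets[OF I(3)]) auto
    have *: "G (min t y) + G (max t y) = G t + G y" for t
      by (auto simp: min_def max_def)
    have "G (b i) - G (a i) = (G (min (b i) y) - G (min (a i) y)) + (G (max (b i) y) - G (max (a i) y))" for i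
      using *[of "a i"] *[of "b i"] by simp
    then show "s = l + (\<Sum>i\<in>I. G (max (b i) y) - G (max (a i) y))"
      unfolding I(4) l_def by (simp add: sum.distrib)
  qed (use I in auto)
qed

text \<open>Sums up to \<open>lo\<close> vanish because \<open>G\<close> is constant there. Each
  further step of length \<open>\<delta> / 2\<close> raises the bound by at most 1: after cutting at
  the previous point, the new pieces are short enough for the tolerance 1. Finitely many steps reach
  \<open>x\<close>.\<close>

lemma bdd_above_interval_sums:
  assumes ac: "abs_continuous_fun_on UNIV G" and const: "\<And>x. x \<le> lo \<Longrightarrow> G x = G lo"
  shows "bdd_above (interval_sums G x)"
proof -
  obtain \<delta> where \<delta>: "\<delta> > 0"
    "\<And>(I :: nat set) a b. finite I \<Longrightarrow> (\<And>i. i \<in> I \<Longrightarrow> a i \<le> b i \<and> {a i..b i} \<subseteq> UNIV) \<Longrightarrow>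
      disjoint_family_on (\<lambda>i. {a i<..<b i}) I \<Longrightarrow> (\<Sum>i\<in>I. b i - a i) < \<delta> \<Longrightarrow>
      (\<Sum>i\<in>I. \<bar>G (b i) - G (a i)\<bar>) < 1"
    using abs_continuous_fun_onE[OF ac zero_less_one, where ?'i = nat] by blast
  \<comment> \<open>The step is half of \<open>\<delta>\<close> because absolute continuity asks for
    a total length strictly below \<open>\<delta>\<close>.\<close>
  have bound: "s \<le> real k" if "s \<in> interval_sums G (lo + real k * (\<delta> / 2))" for k s
    using that
  proof (induction k arbitrary: s)
    case 0
    then obtain I :: "nat set" and a b where "\<forall>i\<in>I. a i \<le> b i \<and> b i \<le> lo" "s = (\<Sum>i\<in>I. G (b i) - G (a i))"
      unfolding interval_sums_def by auto
    moreover have "G (b i) - G (a i) = 0" if "i \<in> I" for i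
      using const[of "a i"] const[of "b i"] calculation(1) that by fastforce
    ultimately show ?case by simp
  next
    case (Suc k)
    obtain l and I :: "nat set" and a b where *: "l \<in> interval_sums G (lo + real k * (\<delta> / 2))" "finite I"
      "\<And>i. i \<in> I \<Longrightarrow> a i \<le> b i \<and> lo + real k * (\<delta> / 2) \<le> a i \<and>
         b i \<le> max (lo + real k * (\<delta> / 2)) (lo + real (Suc k) * (\<delta> / 2))"
      "disjoint_family_on (\<lambda>i. {a i<..<b i}) I" "s = l + (\<Sum>i\<in>I. G (b i) - G (a i))"
      by (rule interval_sums_split[OF Suc.prems, of "lo + real k * (\<delta> / 2)"]) blast
    have m: "max (lo + real k * (\<delta> / 2)) (lo + real (Suc k) * (\<delta> / 2)) = lo + real k * (\<delta> / 2) + \<delta> / 2"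
      using \<delta>(1) by (simp add: algebra_simps)
    have "(\<Sum>i\<in>I. b i - a i) \<le> (lo + real k * (\<delta> / 2) + \<delta> / 2) - (lo + real k * (\<delta> / 2))"
      using *(2,3,4) \<delta>(1) unfolding m by (intro sum_disjoint_lengths_le) auto
    then have "(\<Sum>i\<in>I. \<bar>G (b i) - G (a i)\<bar>) < 1"
      using *(2,3,4) \<delta>(1) by (intro \<delta>(2)) auto
    moreover have "(\<Sum>i\<in>I. G (b i) - G (a i)) \<le> (\<Sum>i\<in>I. \<bar>G (b i) - G (a i)\<bar>)"
      by (intro sum_mono) auto
    ultimately show ?case using *(5) Suc.IH[OF *(1)] by simp
  qed
  obtain k where k: "(x - lo) / (\<delta> / 2) < real k" using reals_Archimedean2 by blast
  then have "x \<le> lo + real k * (\<delta> / 2)" using \<delta>(1) by (simp add: field_simps)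
  then have "interval_sums G x \<subseteq> interval_sums G (lo + real k * (\<delta> / 2))"
    unfolding interval_sums_def by fastforce
  then show ?thesis using bound by (meson bdd_aboveI subsetD)
qed

text \<open>Any family counted in \<open>pos_variation G y\<close> can be joined with the family
  \<open>I\<close> lying between \<open>y\<close> and \<open>z\<close>, and the result is counted in
  \<open>pos_variation G z\<close>. The supremum over the former families gives the claim.\<close>

lemma pos_variation_add_le:
  assumes bdd: "\<And>x. bdd_above (interval_sums G x)" and I: "finite I"
    "\<And>i. i \<in> I \<Longrightarrow> a i \<le> b i \<and> y \<le> a i \<and> b i \<le> z" "disjoint_family_on (\<lambda>i. {a i<..<b i}) I"
    and "y \<le> z"
  shows "pos_variation G y + (\<Sum>i\<in>(I :: nat set). G (b i) - G (a i)) \<le> pos_variation G z"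
proof -
  have "l \<le> pos_variation G z - (\<Sum>i\<in>I. G (b i) - G (a i))" if l: "l \<in> interval_sums G y" for l
  proof -
    obtain J :: "nat set" and c d where J: "finite J" "\<forall>i\<in>J. c i \<le> d i \<and> d i \<le> y"
      "disjoint_family_on (\<lambda>i. {c i<..<d i}) J" "l = (\<Sum>i\<in>J. G (d i) - G (c i))"
      using l unfolding interval_sums_def by blast
    \<comment> \<open>The disjoint union of two index sets of naturals is encoded by parity:
      \<open>2 * i\<close> carries the family \<open>I\<close>, \<open>2 * i + 1\<close> the family
      \<open>J\<close>, and \<open>div 2\<close> recovers \<open>i\<close> in both cases.\<close>
    define A where "A n = (if even n then a (n div 2) else c (n div 2))" for n
    define B where "B n = (if even n then b (n div 2) else d (n div 2))" for n
    define K where "K = (\<lambda>i. 2 * i) ` I \<union> (\<lambda>i. 2 * i + 1) ` J"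
    have "(\<Sum>n\<in>K. G (B n) - G (A n)) \<in> interval_sums G z"
    proof (rule interval_sumsI)
      show "finite K" unfolding K_def using I J by auto
      show "A i \<le> B i \<and> B i \<le> z" if "i \<in> K" for i
        using that I(2) J(2) \<open>y \<le> z\<close> unfolding K_def A_def B_def by fastforce
      show "disjoint_family_on (\<lambda>n. {A n<..<B n}) K"
        unfolding disjoint_family_on_def
      proof (intro ballI impI)
        fix m n assume mn: "m \<in> K" "n \<in> K" "m \<noteq> n"
        have cross: "{a i<..<b i} \<inter> {c j<..<d j} = {}" if "i \<in> I" "j \<in> J" for i j
        proof -
          have "y \<le> a i" "d j \<le> y" using I(2)[OF \<open>i \<in> I\<close>] J(2) \<open>j \<in> J\<close> by auto
          then show ?thesis by auto
        qed
        show "{A m<..<B m} \<inter> {A n<..<B n} = {}"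
        proof (cases "even m"; cases "even n")
          assume "even m" "even n"
          then show ?thesis
            using mn I(3) unfolding K_def A_def B_def disjoint_family_on_def by auto
        next
          assume "even m" "odd n"
          then show ?thesis using mn cross unfolding K_def A_def B_def by auto
        next
          assume "odd m" "even n"
          then show ?thesis
            using mn cross[of "n div 2" "m div 2"] unfolding K_def A_def B_def by (auto simp: Int_commute)
        next
          assume "odd m" "odd n"
          then obtain i j where "i \<in> J" "j \<in> J" "m = 2 * i + 1" "n = 2 * j + 1"
            using mn unfolding K_def by auto
          then show ?thesis
            using disjoint_family_onD[OF J(3), of i j] mn unfolding A_def B_def by simp
        qed
      qed
    qed
    also have "(\<Sum>n\<in>K. G (B n) - G (A n)) = (\<Sum>i\<in>I. G (b i) - G (a i)) + l"
    proof -
      have "(\<Sum>n\<in>K. G (B n) - G (A n)) = (\<Sum>n\<in>(\<lambda>i. 2 * i) ` I. G (B n) - G (A n))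
          + (\<Sum>n\<in>(\<lambda>i. 2 * i + 1) ` J. G (B n) - G (A n))"
        unfolding K_def using I J by (intro sum.union_disjoint) (auto, presburger)
      also have "(\<Sum>n\<in>(\<lambda>i. 2 * i) ` I. G (B n) - G (A n)) = (\<Sum>i\<in>I. G (b i) - G (a i))"
        by (subst sum.reindex) (auto simp: inj_on_def A_def B_def)
      also have "(\<Sum>n\<in>(\<lambda>i. 2 * i + 1) ` J. G (B n) - G (A n)) = l"
        unfolding J(4) by (subst sum.reindex) (auto simp: inj_on_def A_def B_def)
      finally show ?thesis .
    qed
    finally show ?thesis
      unfolding pos_variation_def using cSup_upper[OF _ bdd] by fastforce
  qed
  then have "pos_variation G y \<le> pos_variation G z - (\<Sum>i\<in>I. G (b i) - G (a i))"
    unfolding pos_variation_def[of G y] using zero_in_interval_sums by (intro cSup_least) auto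
  then show ?thesis by simp
qed

lemma mono_pos_variation:
  assumes "\<And>x. bdd_above (interval_sums G x)"
  shows "mono (pos_variation G)"
proof
  fix x y :: real assume "x \<le> y"
  then show "pos_variation G x \<le> pos_variation G y"
    using pos_variation_add_le[OF assms, of "{}" undefined undefined x y]
    by (simp add: disjoint_family_on_def)
qed

text \<open>The family with the single interval \<open>{x..y}\<close>. Together with
  \<open>mono_pos_variation\<close> this is the Jordan decomposition of \<open>G\<close> into
  monotone functions.\<close>

lemma mono_pos_variation_diff:
  assumes "\<And>x. bdd_above (interval_sums G x)"
  shows "mono (\<lambda>x. pos_variation G x - G x)"
proof
  fix x y :: real assume "x \<le> y"
  then show "pos_variation G x - G x \<le> pos_variation G y - G y"
    using pos_variation_add_le[OF assms, of "{0}" "\<lambda>_. x" "\<lambda>_. y" x y]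
    by (simp add: disjoint_family_on_def)
qed

text \<open>Each increment of the positive variation over an interval is nearly attained by the
  increments of \<open>G\<close> over a family inside that interval. These families together are no
  longer than the given intervals, so the absolute continuity of \<open>G\<close> applies to all of
  them at once.\<close>

lemma abs_continuous_pos_variation:
  assumes ac: "abs_continuous_fun_on UNIV G" and bdd: "\<And>x. bdd_above (interval_sums G x)"
  shows "abs_continuous_fun_on UNIV (pos_variation G)"
  unfolding abs_continuous_fun_on_def
proof (intro allI impI)
  fix \<epsilon> :: real assume "\<epsilon> > 0"
  then have e2: "\<epsilon> / 2 > 0" by simp
  obtain \<delta> where \<delta>: "\<delta> > 0"
    "\<And>(I :: (nat \<times> nat) set) a b. finite I \<Longrightarrow> (\<And>i. i \<in> I \<Longrightarrow> a i \<le> b i \<and> {a i..b i} \<subseteq> UNIV) \<Longrightarrow>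
      disjoint_family_on (\<lambda>i. {a i<..<b i}) I \<Longrightarrow> (\<Sum>i\<in>I. b i - a i) < \<delta> \<Longrightarrow>
      (\<Sum>i\<in>I. \<bar>G (b i) - G (a i)\<bar>) < \<epsilon> / 2"
    using abs_continuous_fun_onE[OF ac e2, where ?'i = "nat \<times> nat"] by blast
  let ?P = "pos_variation G"
  show "\<exists>\<delta>>0. \<forall>(I :: nat set) a b. finite I \<longrightarrow> (\<forall>i\<in>I. a i \<le> b i \<and> {a i..b i} \<subseteq> UNIV) \<longrightarrow>
      disjoint_family_on (\<lambda>i. {a i<..<b i}) I \<longrightarrow> (\<Sum>i\<in>I. b i - a i) < \<delta> \<longrightarrow>
      (\<Sum>i\<in>I. \<bar>?P (b i) - ?P (a i)\<bar>) < \<epsilon>"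
  proof (intro exI[of _ \<delta>] conjI allI impI)
    fix J :: "nat set" and c d
    assume J: "finite J" "\<forall>i\<in>J. c i \<le> d i \<and> {c i..d i} \<subseteq> UNIV"
      "disjoint_family_on (\<lambda>i. {c i<..<d i}) J" "(\<Sum>i\<in>J. d i - c i) < \<delta>"
    \<comment> \<open>Each of the \<open>card J\<close> intervals may lose \<open>\<eta>\<close>, in
      total at most \<open>\<epsilon> / 2\<close>; the added 1 keeps the denominator positive for
      empty \<open>J\<close>.\<close>
    define \<eta> where "\<eta> = \<epsilon> / (2 * (real (card J) + 1))"
    have "\<eta> > 0" unfolding \<eta>_def using \<open>\<epsilon> > 0\<close> by simp
    define Q where "Q k I a b \<longleftrightarrow> finite I \<and> (\<forall>i\<in>I. a i \<le> b i \<and> c k \<le> a i \<and> b i \<le> d k) \<and>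
        disjoint_family_on (\<lambda>i. {a i<..<b i}) I \<and> ?P (d k) - ?P (c k) \<le> (\<Sum>i\<in>I. G (b i) - G (a i)) + \<eta>"
      for k and I :: "nat set" and a b
    have "\<exists>I a b. Q k I a b" if "k \<in> J" for k
    proof -
      \<comment> \<open>A nearly optimal family for \<open>d k\<close> is cut at \<open>c k\<close>.
        What lies to the left contributes at most \<open>?P (c k)\<close>, so the pieces inside
        \<open>{c k..d k}\<close> account for the increment up to \<open>\<eta>\<close>.\<close>
      have "?P (d k) - \<eta> < Sup (interval_sums G (d k))"
        unfolding pos_variation_def using \<open>\<eta> > 0\<close> by simp
      then obtain s where s: "s \<in> interval_sums G (d k)" "?P (d k) - \<eta> < s"
        using less_cSupE[of "?P (d k) - \<eta>" "interval_sums G (d k)"] zero_in_interval_sums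
        by (metis empty_iff)
      obtain l and I :: "nat set" and a b where *: "l \<in> interval_sums G (c k)" "finite I"
        "\<And>i. i \<in> I \<Longrightarrow> a i \<le> b i \<and> c k \<le> a i \<and> b i \<le> max (c k) (d k)"
        "disjoint_family_on (\<lambda>i. {a i<..<b i}) I" "s = l + (\<Sum>i\<in>I. G (b i) - G (a i))"
        by (rule interval_sums_split[OF s(1), of "c k"]) blast
      have "l \<le> ?P (c k)"
        unfolding pos_variation_def by (rule cSup_upper[OF *(1) bdd])
      then have "?P (d k) - ?P (c k) \<le> (\<Sum>i\<in>I. G (b i) - G (a i)) + \<eta>"
        using s(2) *(5) by linarith
      moreover have "\<forall>i\<in>I. a i \<le> b i \<and> c k \<le> a i \<and> b i \<le> d k"
        using *(3) J(2) \<open>k \<in> J\<close> by fastforce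
      ultimately show ?thesis unfolding Q_def using *(2,4) by blast
    qed
    then obtain I a b where Q: "\<And>k. k \<in> J \<Longrightarrow> Q k (I k) (a k) (b k)"
      by metis
    have I: "\<And>k. k \<in> J \<Longrightarrow> finite (I k)"
      "\<And>k i. k \<in> J \<Longrightarrow> i \<in> I k \<Longrightarrow> a k i \<le> b k i \<and> c k \<le> a k i \<and> b k i \<le> d k"
      "\<And>k. k \<in> J \<Longrightarrow> disjoint_family_on (\<lambda>i. {a k i<..<b k i}) (I k)"
      "\<And>k. k \<in> J \<Longrightarrow> ?P (d k) - ?P (c k) \<le> (\<Sum>i\<in>I k. G (b k i) - G (a k i)) + \<eta>"
      using Q unfolding Q_def by blast+
    \<comment> \<open>The pieces of all intervals form one family indexed by pairs, so a single use
      of \<open>\<delta>\<close> covers them.\<close>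
    define S where "S = Sigma J I"
    have "(\<Sum>p\<in>S. \<bar>G (b (fst p) (snd p)) - G (a (fst p) (snd p))\<bar>) < \<epsilon> / 2"
    proof (rule \<delta>(2))
      show "finite S" unfolding S_def using J(1) I(1) by blast
      show "disjoint_family_on (\<lambda>p. {a (fst p) (snd p)<..<b (fst p) (snd p)}) S"
        unfolding disjoint_family_on_def
      proof (intro ballI impI)
        fix p q assume pq: "p \<in> S" "q \<in> S" "p \<noteq> q"
        obtain k i where p [simp]: "p = (k, i)" by (rule prod.exhaust)
        obtain l j where q [simp]: "q = (l, j)" by (rule prod.exhaust)
        have kl: "k \<in> J" "l \<in> J" "i \<in> I k" "j \<in> I l" using pq unfolding S_def by auto
        show "{a (fst p) (snd p)<..<b (fst p) (snd p)} \<inter> {a (fst q) (snd q)<..<b (fst q) (snd q)} = {}"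
        proof (cases "k = l")
          case True
          then show ?thesis
            using disjoint_family_onD[OF I(3)[of k], of i j] kl pq by simp
        next
          case False
          have "{c k<..<d k} \<inter> {c l<..<d l} = {}"
            using J(3) kl False unfolding disjoint_family_on_def by blast
          moreover have "{a k i<..<b k i} \<subseteq> {c k<..<d k}" "{a l j<..<b l j} \<subseteq> {c l<..<d l}"
            using I(2)[of k i] I(2)[of l j] kl by auto
          ultimately show ?thesis unfolding p q fst_conv snd_conv by blast
        qed
      qed
      have "(\<Sum>p\<in>S. b (fst p) (snd p) - a (fst p) (snd p)) = (\<Sum>k\<in>J. \<Sum>i\<in>I k. b k i - a k i)"
        unfolding S_def using J(1) I(1) by (subst sum.Sigma) (auto simp: case_prod_unfold)
      also have "\<dots> \<le> (\<Sum>k\<in>J. d k - c k)"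
        using I J by (intro sum_mono sum_disjoint_lengths_le) auto
      finally show "(\<Sum>p\<in>S. b (fst p) (snd p) - a (fst p) (snd p)) < \<delta>" using J(4) by simp
    qed (use I(2) in \<open>auto simp: S_def\<close>)
    moreover have "(\<Sum>k\<in>J. \<bar>?P (d k) - ?P (c k)\<bar>) \<le> (\<Sum>k\<in>J. (\<Sum>i\<in>I k. \<bar>G (b k i) - G (a k i)\<bar>) + \<eta>)"
    proof (rule sum_mono)
      fix k assume k: "k \<in> J"
      have "?P (c k) \<le> ?P (d k)" using monoD[OF mono_pos_variation[OF bdd]] J(2) k by blast
      moreover have "(\<Sum>i\<in>I k. G (b k i) - G (a k i)) \<le> (\<Sum>i\<in>I k. \<bar>G (b k i) - G (a k i)\<bar>)"
        by (intro sum_mono) auto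
      ultimately show "\<bar>?P (d k) - ?P (c k)\<bar> \<le> (\<Sum>i\<in>I k. \<bar>G (b k i) - G (a k i)\<bar>) + \<eta>"
        using I(4)[OF k] by linarith
    qed
    moreover have "(\<Sum>k\<in>J. (\<Sum>i\<in>I k. \<bar>G (b k i) - G (a k i)\<bar>) + \<eta>)
        = (\<Sum>p\<in>S. \<bar>G (b (fst p) (snd p)) - G (a (fst p) (snd p))\<bar>) + real (card J) * \<eta>"
      unfolding S_def sum.distrib using J(1) I(1) by (subst sum.Sigma) (auto simp: case_prod_unfold)
    moreover have "real (card J) * \<eta> \<le> \<epsilon> / 2"
      unfolding \<eta>_def using \<open>\<epsilon> > 0\<close> by (simp add: field_simps)
    ultimately show "(\<Sum>k\<in>J. \<bar>?P (d k) - ?P (c k)\<bar>) < \<epsilon>" by linarith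
  qed (rule \<delta>(1))
qed

section \<open>Stieltjes measures and their densities\<close>

text \<open>A bounded null set is covered by countably many nonoverlapping compact intervals of
  small total length. Absolute continuity bounds the Stieltjes measure of every finite subfamily,
  and continuity from below extends the bound to the whole cover.\<close>

lemma emeasure_interval_measure_null_le:
  fixes F :: "real \<Rightarrow> real"
  assumes F: "mono F" "abs_continuous_fun_on UNIV F" and "\<epsilon> > 0"
    and N: "N \<in> null_sets lborel" "N \<subseteq> {u..v}"
  shows "emeasure (interval_measure F) N \<le> ennreal \<epsilon>"
proof -
  have cont: "continuous_on UNIV F"
    using F(2) by (rule abs_continuous_imp_continuous)
  obtain \<delta> where \<delta>: "\<delta> > 0"
    "\<And>(I :: real set set) a b. finite I \<Longrightarrow> (\<And>i. i \<in> I \<Longrightarrow> a i \<le> b i \<and> {a i..b i} \<subseteq> UNIV) \<Longrightarrow>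
      disjoint_family_on (\<lambda>i. {a i<..<b i}) I \<Longrightarrow> (\<Sum>i\<in>I. b i - a i) < \<delta> \<Longrightarrow>
      (\<Sum>i\<in>I. \<bar>F (b i) - F (a i)\<bar>) < \<epsilon>"
    using abs_continuous_fun_onE[OF F(2) \<open>\<epsilon> > 0\<close>, where ?'i = "real set"] by blast
  have N': "N \<in> null_sets lebesgue"
    using N(1) by (rule null_sets_completionI)
  then have "N \<in> lmeasurable"
    by (simp add: fmeasurable_def null_sets_def)
  \<comment> \<open>The total length is at most \<open>\<delta> / 2\<close> because \<open>N\<close>
    is null; the boundedness of \<open>N\<close> enters here.\<close>
  obtain \<D> where \<D>: "countable \<D>" "\<And>K. K \<in> \<D> \<Longrightarrow> K \<noteq> {} \<and> (\<exists>c d. K = cbox c d)"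
    "pairwise (\<lambda>A B. interior A \<inter> interior B = {}) \<D>"
    "N \<subseteq> \<Union>\<D>" "\<Union>\<D> \<in> lmeasurable" "measure lebesgue (\<Union>\<D>) \<le> measure lebesgue N + \<delta> / 2"
    using measurable_outer_intervals_bounded[of N u v "\<delta> / 2"] \<open>N \<in> lmeasurable\<close> N(2) \<delta>(1)
    by (metis half_gt_zero interval_cbox)
  \<comment> \<open>A nonempty compact interval has its end points as infimum and supremum, so the
    intervals can serve as their own index set.\<close>
  define c d where "c K = Inf K" and "d K = Sup K" for K :: "real set"
  have K: "K = {c K..d K} \<and> c K \<le> d K" if "K \<in> \<D>" for K
  proof -
    obtain p q where "K = {p..q}" "p \<le> q"
    proof -
      obtain p q where pq: "K = cbox p q" "K \<noteq> {}" using \<D>(2)[OF \<open>K \<in> \<D>\<close>] by blast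
      then show thesis using that[of p q] by (auto simp: cbox_interval)
    qed
    then show ?thesis unfolding c_def d_def by simp
  qed
  have fin: "sum (emeasure (interval_measure F)) \<F> \<le> ennreal \<epsilon>" if \<F>: "finite \<F>" "\<F> \<subseteq> \<D>" for \<F>
  proof -
    have disj: "disjoint_family_on (\<lambda>K. {c K<..<d K}) \<F>"
    proof (unfold disjoint_family_on_def, intro ballI impI)
      fix A B assume AB: "A \<in> \<F>" "B \<in> \<F>" "A \<noteq> B"
      have "interior A \<inter> interior B = {}"
        using \<D>(3) AB \<F>(2) unfolding pairwise_def by blast
      moreover have "interior A = {c A<..<d A}" "interior B = {c B<..<d B}"
        using K[of A] K[of B] AB \<F>(2) interior_atLeastAtMost_real by (metis subsetD)+
      ultimately show "{c A<..<d A} \<inter> {c B<..<d B} = {}" by simp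
    qed
    have le: "c K \<le> d K" if "K \<in> \<F>" for K using K \<F>(2) that by blast
    have "(\<Sum>K\<in>\<F>. d K - c K) = (\<Sum>K\<in>\<F>. measure lebesgue {c K<..<d K})"
      using le by (intro sum.cong) auto
    also have "\<dots> = measure lebesgue (\<Union>K\<in>\<F>. {c K<..<d K})"
      using disj \<F>(1) le by (intro measure_finite_Union[symmetric]) auto
    also have "\<dots> \<le> measure lebesgue (\<Union>\<D>)"
    proof (intro measure_mono_fmeasurable \<D>(5))
      have "{c K<..<d K} \<subseteq> \<Union>\<D>" if "K \<in> \<F>" for K
      proof -
        have "K \<in> \<D>" "K = {c K..d K}" using that \<F>(2) K by auto
        moreover have "{c K<..<d K} \<subseteq> {c K..d K}" by auto
        ultimately show ?thesis by blast
      qed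
      then show "(\<Union>K\<in>\<F>. {c K<..<d K}) \<subseteq> \<Union>\<D>" by blast
    qed (use \<F>(1) in auto)
    also have "\<dots> < \<delta>"
      using \<D>(6) N' \<delta>(1) by (simp add: measure_eq_0_null_sets)
    finally have "(\<Sum>K\<in>\<F>. \<bar>F (d K) - F (c K)\<bar>) < \<epsilon>"
      using disj \<F>(1) le by (intro \<delta>(2)) auto
    moreover have "sum (emeasure (interval_measure F)) \<F> = (\<Sum>K\<in>\<F>. ennreal \<bar>F (d K) - F (c K)\<bar>)"
    proof (rule sum.cong[OF refl])
      fix A assume "A \<in> \<F>"
      then have A: "A = {c A..d A}" "c A \<le> d A" using K \<F>(2) by auto
      have "emeasure (interval_measure F) {c A..d A} = ennreal (F (d A) - F (c A))"
        using A(2) F(1) cont by (intro emeasure_interval_measure_Icc) (auto simp: mono_def)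
      then show "emeasure (interval_measure F) A = ennreal \<bar>F (d A) - F (c A)\<bar>"
        using A F(1) by (simp add: mono_def)
    qed
    ultimately show ?thesis by (simp add: ennreal_leI)
  qed
  show ?thesis
  proof (cases "\<D> = {}")
    case True
    then show ?thesis using \<D>(4) by simp
  next
    case False
    \<comment> \<open>A finite \<open>\<D>\<close> is enumerated with repetitions. They are
      harmless, since sums are taken over images of initial segments under \<open>e\<close>, in
      which repetitions disappear.\<close>
    define e where "e = from_nat_into \<D>"
    have e: "range e = \<D>"
      unfolding e_def using False \<D>(1) by (rule range_from_nat_into)
    have meas: "K \<in> sets (interval_measure F)" if "K \<in> \<D>" for K
    proof -
      have "{c K..d K} \<in> sets (interval_measure F)" by simp
      then show ?thesis using K[OF that] by simp
    qed
    have "emeasure (interval_measure F) N \<le> emeasure (interval_measure F) (\<Union>n. \<Union>(e ` {..n}))"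
    proof (rule emeasure_mono)
      show "N \<subseteq> (\<Union>n. \<Union>(e ` {..n}))" using \<D>(4) unfolding e[symmetric] by blast
      show "(\<Union>n. \<Union>(e ` {..n})) \<in> sets (interval_measure F)"
        using meas e by (intro sets.countable_UN' sets.finite_Union) auto
    qed
    also have "\<dots> = (SUP n. emeasure (interval_measure F) (\<Union>(e ` {..n})))"
    proof (rule SUP_emeasure_incseq[symmetric])
      show "range (\<lambda>n. \<Union>(e ` {..n})) \<subseteq> sets (interval_measure F)"
        using meas e by (auto intro!: sets.finite_Union)
      show "incseq (\<lambda>n. \<Union>(e ` {..n}))"
        by (intro monoI Union_mono image_mono) auto
    qed
    also have "\<dots> \<le> ennreal \<epsilon>"
    proof (rule SUP_least)
      fix n
      have "emeasure (interval_measure F) (\<Union>K\<in>e ` {..n}. K) \<le> sum (emeasure (interval_measure F)) (e ` {..n})"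
        using meas e by (intro emeasure_subadditive_finite) auto
      also have "\<dots> \<le> ennreal \<epsilon>" using e by (intro fin) auto
      finally show "emeasure (interval_measure F) (\<Union>(e ` {..n})) \<le> ennreal \<epsilon>" by simp
    qed
    finally show ?thesis .
  qed
qed

text \<open>A null set is exhausted by its bounded parts, whose measure is below every positive
  \<open>\<epsilon>\<close>.\<close>

lemma absolutely_continuous_interval_measure:
  fixes F :: "real \<Rightarrow> real"
  assumes "mono F" "abs_continuous_fun_on UNIV F"
  shows "absolutely_continuous lborel (interval_measure F)"
proof -
  have "N \<in> null_sets (interval_measure F)" if N: "N \<in> null_sets lborel" for N
  proof -
    have "N \<inter> {- real n..real n} \<in> null_sets (interval_measure F)" for n
    proof -
      have "N \<inter> {- real n..real n} \<in> null_sets lborel"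
        using N by (rule null_set_Int2) simp
      then have "emeasure (interval_measure F) (N \<inter> {- real n..real n}) \<le> ennreal \<epsilon>" if "\<epsilon> > 0" for \<epsilon>
        using assms that by (intro emeasure_interval_measure_null_le) auto
      then have "emeasure (interval_measure F) (N \<inter> {- real n..real n}) = 0"
        by (metis ennreal_0 ennreal_le_epsilon add_0 le_zero_eq)
      then show ?thesis using N by (auto simp: null_sets_def)
    qed
    then have "(\<Union>n. N \<inter> {- real n..real n}) \<in> null_sets (interval_measure F)"
      by (intro null_sets_UN) auto
    moreover have "(\<Union>n. N \<inter> {- real n..real n}) = N"
    proof -
      have "\<exists>n. x \<in> {- real n..real n}" for x
        using real_arch_simple[of "\<bar>x\<bar>"] by (force simp: abs_le_iff)
      then show ?thesis by blast
    qed
    ultimately show ?thesis by simp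
  qed
  then show ?thesis unfolding absolutely_continuous_def by blast
qed

text \<open>The Radon-Nikodym derivative of the Stieltjes measure takes values in
  \<open>ennreal\<close>. Sigma-finiteness of that measure makes it finite almost everywhere, so
  passing to real values does not change its integrals.\<close>

lemma mono_abs_continuous_density:
  fixes F :: "real \<Rightarrow> real"
  assumes F: "mono F" "abs_continuous_fun_on UNIV F"
  obtains f :: "real \<Rightarrow> real" where "f \<in> borel_measurable borel" "\<And>x. 0 \<le> f x"
    "\<And>a b. a \<le> b \<Longrightarrow> (\<integral>\<^sup>+x\<in>{a..b}. ennreal (f x) \<partial>lborel) = ennreal (F b - F a)"
proof -
  have cont: "continuous_on UNIV F"
    using F(2) by (rule abs_continuous_imp_continuous)
  obtain h where h: "h \<in> borel_measurable lborel" "density lborel h = interval_measure F"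
    using sigma_finite_measure.Radon_Nikodym[OF sigma_finite_lborel absolutely_continuous_interval_measure[OF F]] by auto
  have "sigma_finite_measure (interval_measure F)"
    using F(1) cont
    by (intro sigma_finite_interval_measure)
      (auto simp: mono_def continuous_on_eq_continuous_within intro: continuous_within_subset)
  then have fin: "AE x in lborel. h x \<noteq> \<infinity>"
    using sigma_finite_measure.sigma_finite_iff_density_finite[OF sigma_finite_lborel h(1)] h(2) by simp
  have [measurable]: "h \<in> borel_measurable borel" using h(1) by simp
  show thesis
  proof (rule that[of "\<lambda>x. enn2real (h x)"])
    fix a b :: real assume "a \<le> b"
    have "(\<integral>\<^sup>+x\<in>{a..b}. ennreal (enn2real (h x)) \<partial>lborel) = (\<integral>\<^sup>+x\<in>{a..b}. h x \<partial>lborel)"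
      using fin by (intro nn_integral_cong_AE) (auto elim!: eventually_mono simp: less_top)
    also have "\<dots> = emeasure (density lborel h) {a..b}"
      by (simp add: emeasure_density)
    also have "\<dots> = ennreal (F b - F a)"
      unfolding h(2) using \<open>a \<le> b\<close> F(1) cont
      by (intro emeasure_interval_measure_Icc) (auto simp: mono_def)
    finally show "(\<integral>\<^sup>+x\<in>{a..b}. ennreal (enn2real (h x)) \<partial>lborel) = ennreal (F b - F a)" .
  qed auto
qed

section \<open>Differentiation almost everywhere\<close>

text \<open>The differentiation theorem applied next concerns the gauge integral, hence the change
  from the Lebesgue integral.\<close>

lemma density_has_integral:
  fixes F f :: "real \<Rightarrow> real"
  assumes f: "f \<in> borel_measurable borel" "\<And>x. 0 \<le> f x"
    and F: "\<And>a b. a \<le> b \<Longrightarrow> (\<integral>\<^sup>+x\<in>{a..b}. ennreal (f x) \<partial>lborel) = ennreal (F b - F a)"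
    and "mono F" "a \<le> b"
  shows "(f has_integral (F b - F a)) {a..b}"
proof -
  have "((\<lambda>x. f x * indicator {a..b} x) has_integral (F b - F a)) UNIV"
  proof (rule nn_integral_has_integral)
    have "(\<integral>\<^sup>+x. ennreal (f x * indicator {a..b} x) \<partial>lborel) = (\<integral>\<^sup>+x\<in>{a..b}. ennreal (f x) \<partial>lborel)"
      by (intro nn_integral_cong) (auto split: split_indicator)
    then show "(\<integral>\<^sup>+x. ennreal (f x * indicator {a..b} x) \<partial>lborel) = ennreal (F b - F a)"
      using F \<open>a \<le> b\<close> by simp
  qed (use assms in \<open>auto simp: mono_def\<close>)
  moreover have "(\<lambda>x. f x * indicator {a..b} x) = (\<lambda>x. if x \<in> {a..b} then f x else 0)"
    by (auto split: split_indicator)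
  ultimately show ?thesis
    using has_integral_restrict_UNIV[of "{a..b}" f] by simp
qed

text \<open>Lebesgue differentiation: at almost every point \<open>f x\<close> is the limit of its
  averages over \<open>{x..x + h}\<close>, and these are the right difference quotients of
  \<open>F\<close>. The underlying theorem concerns cubes with lower corner \<open>x\<close>, so
  only positive \<open>h\<close> is covered.\<close>

lemma density_right_derivative:
  fixes F f :: "real \<Rightarrow> real"
  assumes f: "f \<in> borel_measurable borel" "\<And>x. 0 \<le> f x"
    and F: "\<And>a b. a \<le> b \<Longrightarrow> (\<integral>\<^sup>+x\<in>{a..b}. ennreal (f x) \<partial>lborel) = ennreal (F b - F a)"
    and "mono F"
  obtains N where "negligible N" "\<And>x e. x \<notin> N \<Longrightarrow> e > 0 \<Longrightarrow>
    \<exists>d>0. \<forall>h. 0 < h \<and> h < d \<longrightarrow> \<bar>(F (x + h) - F x) / h - f x\<bar> < e"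
proof -
  have int: "(f has_integral (F b - F a)) {a..b}" if "a \<le> b" for a b
    using assms that by (rule density_has_integral)
  have "f integrable_on cbox a b" for a b
    using int[of a b] by (cases "a \<le> b") (auto simp: cbox_interval)
  then obtain N where N: "negligible N" "\<And>x e. x \<notin> N \<Longrightarrow> 0 < e \<Longrightarrow> \<exists>d>0. \<forall>h. 0 < h \<and> h < d \<longrightarrow>
      norm (integral (cbox x (x + h *\<^sub>R One)) f /\<^sub>R h ^ DIM(real) - f x) < e"
    using integrable_ccontinuous_explicit[of f] by blast
  have "integral (cbox x (x + h *\<^sub>R One)) f /\<^sub>R h ^ DIM(real) = (F (x + h) - F x) / h" if "h > 0" for x h
    using integral_unique[OF int[of x "x + h"]] that by (simp add: cbox_interval divide_inverse mult.commute)
  then have "\<exists>d>0. \<forall>h. 0 < h \<and> h < d \<longrightarrow> \<bar>(F (x + h) - F x) / h - f x\<bar> < e"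
    if "x \<notin> N" "e > 0" for x e
    using N(2)[OF that] by (metis real_norm_def)
  then show thesis using that N(1) by blast
qed

text \<open>A negligible set is null for the completed measure; a Borel null set containing it
  transfers this to \<open>lborel\<close>.\<close>

lemma negligible_imp_AE_notin:
  assumes "negligible N"
  shows "AE x in lborel. x \<notin> N"
proof -
  have "N \<in> null_sets (completion lborel)"
    using assms by (simp add: negligible_iff_null_sets)
  then obtain N' where "N' \<in> null_sets lborel" "N \<subseteq> N'"
    by (auto simp: null_sets_completion_iff2)
  then show ?thesis
    by (auto intro: AE_I'[of N'])
qed

text \<open>The left derivative of \<open>F\<close> at \<open>x\<close> is the right derivative at
  \<open>- x\<close> of the reflected function \<open>\<lambda>x. - F (- x)\<close>, which has the
  density \<open>\<lambda>x. f (- x)\<close>. The one-sided result for both functions gives the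
  two-sided derivative off two negligible sets.\<close>

lemma AE_density_derivative:
  fixes F f :: "real \<Rightarrow> real"
  assumes f: "f \<in> borel_measurable borel" "\<And>x. 0 \<le> f x"
    and F: "\<And>a b. a \<le> b \<Longrightarrow> (\<integral>\<^sup>+x\<in>{a..b}. ennreal (f x) \<partial>lborel) = ennreal (F b - F a)"
    and "mono F"
  shows "AE x in lborel. (F has_real_derivative f x) (at x)"
proof -
  obtain N where N: "negligible N" "\<And>x e. x \<notin> N \<Longrightarrow> e > 0 \<Longrightarrow>
    \<exists>d>0. \<forall>h. 0 < h \<and> h < d \<longrightarrow> \<bar>(F (x + h) - F x) / h - f x\<bar> < e"
    using density_right_derivative[OF f F \<open>mono F\<close>] by blast
  obtain L where L: "negligible L" "\<And>x e. x \<notin> L \<Longrightarrow> e > 0 \<Longrightarrow>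
    \<exists>d>0. \<forall>h. 0 < h \<and> h < d \<longrightarrow> \<bar>(- F (- (x + h)) - - F (- x)) / h - f (- x)\<bar> < e"
  proof (rule density_right_derivative[of "\<lambda>x. f (- x)" "\<lambda>x. - F (- x)"])
    show "(\<lambda>x. f (- x)) \<in> borel_measurable borel" using f(1) by measurable
    show "mono (\<lambda>x. - F (- x))" using \<open>mono F\<close> by (simp add: mono_def)
    fix a b :: real assume "a \<le> b"
    have [measurable]: "(\<lambda>x. ennreal (f (- x)) * indicator {a..b} x) \<in> borel_measurable borel"
      using f(1) by measurable
    have "(\<integral>\<^sup>+x\<in>{a..b}. ennreal (f (- x)) \<partial>lborel)
        = (\<integral>\<^sup>+x. ennreal (f (- x)) * indicator {a..b} x \<partial>distr lborel borel uminus)"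
      by (simp add: lborel_distr_uminus)
    also have "\<dots> = (\<integral>\<^sup>+x. ennreal (f x) * indicator {a..b} (- x) \<partial>lborel)"
      by (subst nn_integral_distr) auto
    also have "\<dots> = (\<integral>\<^sup>+x\<in>{- b..- a}. ennreal (f x) \<partial>lborel)"
      by (intro nn_integral_cong) (auto split: split_indicator)
    also have "\<dots> = ennreal (- F (- b) - - F (- a))"
      using F[of "- b" "- a"] \<open>a \<le> b\<close> by simp
    finally show "(\<integral>\<^sup>+x\<in>{a..b}. ennreal (f (- x)) \<partial>lborel) = ennreal (- F (- b) - - F (- a))" .
  qed (use f in auto)
  \<comment> \<open>The exceptional set of the reflected function has to be reflected back; a
    differentiable map keeps it negligible.\<close>
  have "negligible (uminus ` L)"
    using L(1) by (intro negligible_differentiable_image_negligible) (auto simp: differentiable_on_def)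
  then have "AE x in lborel. x \<notin> N \<and> x \<notin> uminus ` L"
    using negligible_imp_AE_notin N(1) by auto
  then show ?thesis
  proof (rule AE_mp, intro AE_I2 impI)
    fix x assume x: "x \<notin> N \<and> x \<notin> uminus ` L"
    show "(F has_real_derivative f x) (at x)"
      unfolding DERIV_def LIM_eq
    proof (intro allI impI)
      fix e :: real assume "e > 0"
      obtain d where d: "d > 0" "\<And>h. 0 < h \<and> h < d \<Longrightarrow> \<bar>(F (x + h) - F x) / h - f x\<bar> < e"
        using N(2)[of x e] x \<open>e > 0\<close> by blast
      have "- x \<notin> L" using x by force
      then obtain d' where d': "d' > 0"
        "\<And>h. 0 < h \<and> h < d' \<Longrightarrow> \<bar>(- F (- (- x + h)) - - F (- (- x))) / h - f (- (- x))\<bar> < e"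
        using L(2)[of "- x" e] \<open>e > 0\<close> by blast
      have "\<bar>(F (x + h) - F x) / h - f x\<bar> < e" if "h \<noteq> 0" "\<bar>h\<bar> < min d d'" for h
      proof (cases "h > 0")
        case True
        then show ?thesis using d(2) that by simp
      next
        case False
        then have "(- F (- (- x + (- h))) - - F (- (- x))) / (- h) = (F (x + h) - F x) / h"
          by (simp add: diff_divide_distrib add.commute)
        then show ?thesis using d'(2)[of "- h"] that False by simp
      qed
      then show "\<exists>s>0. \<forall>h. h \<noteq> 0 \<and> norm (h - 0) < s \<longrightarrow> norm ((F (x + h) - F x) / h - f x) < e"
        using d(1) d'(1) by (intro exI[of _ "min d d'"]) auto
    qed
  qed
qed

text \<open>The witness is \<open>p - q\<close>, the difference of the densities of the two Jordan
  parts \<open>P\<close> and \<open>Q\<close>. The increment bound is what the Cauchy-Schwarz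
  estimate consumes later.\<close>

lemma abs_continuous_UNIV_derivative:
  fixes G :: "real \<Rightarrow> real"
  assumes ac: "abs_continuous_fun_on UNIV G" and const: "\<And>x. x \<le> lo \<Longrightarrow> G x = G lo"
  obtains f where "f \<in> borel_measurable borel"
    "AE x in lborel. (G has_real_derivative f x) (at x)"
    "\<And>a b. a \<le> b \<Longrightarrow> ennreal \<bar>G b - G a\<bar> \<le> (\<integral>\<^sup>+x\<in>{a..b}. ennreal \<bar>f x\<bar> \<partial>lborel)"
proof -
  have bdd: "\<And>x. bdd_above (interval_sums G x)"
    using assms by (rule bdd_above_interval_sums)
  define P Q where "P = pos_variation G" and "Q = (\<lambda>x. pos_variation G x - G x)"
  have mono: "mono P" "mono Q"
    unfolding P_def Q_def using bdd by (intro mono_pos_variation mono_pos_variation_diff; simp)+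
  have acP: "abs_continuous_fun_on UNIV P" "abs_continuous_fun_on UNIV Q"
    unfolding P_def Q_def
    using abs_continuous_pos_variation[OF ac bdd] ac by (auto intro: abs_continuous_fun_on_diff)
  obtain p where p: "p \<in> borel_measurable borel" "\<And>x. 0 \<le> p x"
    "\<And>a b. a \<le> b \<Longrightarrow> (\<integral>\<^sup>+x\<in>{a..b}. ennreal (p x) \<partial>lborel) = ennreal (P b - P a)"
    using mono_abs_continuous_density[OF mono(1) acP(1)] by blast
  obtain q where q: "q \<in> borel_measurable borel" "\<And>x. 0 \<le> q x"
    "\<And>a b. a \<le> b \<Longrightarrow> (\<integral>\<^sup>+x\<in>{a..b}. ennreal (q x) \<partial>lborel) = ennreal (Q b - Q a)"
    using mono_abs_continuous_density[OF mono(2) acP(2)] by blast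
  note [measurable] = p(1) q(1)
  have G: "G x = P x - Q x" for x unfolding P_def Q_def by simp
  show thesis
  proof (rule that[of "\<lambda>x. p x - q x"])
    have "AE x in lborel. (P has_real_derivative p x) (at x)"
      using p mono(1) by (intro AE_density_derivative) auto
    moreover have "AE x in lborel. (Q has_real_derivative q x) (at x)"
      using q mono(2) by (intro AE_density_derivative) auto
    ultimately show "AE x in lborel. (G has_real_derivative p x - q x) (at x)"
      unfolding G[abs_def] by (auto elim!: eventually_elim2 intro: DERIV_diff)
    fix a b :: real assume "a \<le> b"
    \<comment> \<open>Subtraction in \<open>ennreal\<close> is avoided:
      \<open>p \<le> q + |p - q|\<close> and its mirror image are integrated and then compared as
      real numbers. An infinite \<open>?J\<close> makes the claim trivial.\<close>
    let ?J = "\<integral>\<^sup>+x\<in>{a..b}. ennreal \<bar>p x - q x\<bar> \<partial>lborel"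
    have "(\<integral>\<^sup>+x\<in>{a..b}. ennreal (p x) \<partial>lborel)
        \<le> (\<integral>\<^sup>+x. ennreal (q x) * indicator {a..b} x + ennreal \<bar>p x - q x\<bar> * indicator {a..b} x \<partial>lborel)"
      using q(2) by (intro nn_integral_mono)
        (auto simp: ennreal_plus[symmetric] simp del: ennreal_plus split: split_indicator intro!: ennreal_leI)
    also have "\<dots> = (\<integral>\<^sup>+x\<in>{a..b}. ennreal (q x) \<partial>lborel) + ?J"
      by (rule nn_integral_add) auto
    finally have 1: "ennreal (P b - P a) \<le> ennreal (Q b - Q a) + ?J"
      using p(3) q(3) \<open>a \<le> b\<close> by simp
    have "(\<integral>\<^sup>+x\<in>{a..b}. ennreal (q x) \<partial>lborel)
        \<le> (\<integral>\<^sup>+x. ennreal (p x) * indicator {a..b} x + ennreal \<bar>p x - q x\<bar> * indicator {a..b} x \<partial>lborel)"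
      using p(2) by (intro nn_integral_mono)
        (auto simp: ennreal_plus[symmetric] simp del: ennreal_plus split: split_indicator intro!: ennreal_leI)
    also have "\<dots> = (\<integral>\<^sup>+x\<in>{a..b}. ennreal (p x) \<partial>lborel) + ?J"
      by (rule nn_integral_add) auto
    finally have 2: "ennreal (Q b - Q a) \<le> ennreal (P b - P a) + ?J"
      using p(3) q(3) \<open>a \<le> b\<close> by simp
    have nn: "0 \<le> P b - P a" "0 \<le> Q b - Q a" using mono \<open>a \<le> b\<close> by (auto simp: mono_def)
    show "ennreal \<bar>G b - G a\<bar> \<le> ?J"
    proof (cases ?J)
      case (real r)
      then have "P b - P a \<le> Q b - Q a + r" "Q b - Q a \<le> P b - P a + r"
        using 1 2 nn by (simp_all add: ennreal_plus[symmetric] del: ennreal_plus)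
      then show ?thesis unfolding real(2) G by (intro ennreal_leI) linarith
    qed simp
  qed auto
qed

section \<open>From the whole line to local absolute continuity\<close>

text \<open>Clamping the arguments to \<open>{u..v}\<close> shortens intervals and keeps them
  disjoint. Thus \<open>g\<close> on a compact interval extends to an absolutely continuous function
  on the line that is constant to either side.\<close>

lemma abs_continuous_fun_on_clamp:
  assumes "abs_continuous_fun_on {u..v} g" "u \<le> v"
  shows "abs_continuous_fun_on UNIV (\<lambda>x. g (max u (min v x)))"
  unfolding abs_continuous_fun_on_def
proof (intro allI impI)
  fix \<epsilon> :: real assume "\<epsilon> > 0"
  obtain \<delta> where \<delta>: "\<delta> > 0"
    "\<And>(I :: nat set) a b. finite I \<Longrightarrow> (\<And>i. i \<in> I \<Longrightarrow> a i \<le> b i \<and> {a i..b i} \<subseteq> {u..v}) \<Longrightarrow>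
      disjoint_family_on (\<lambda>i. {a i<..<b i}) I \<Longrightarrow> (\<Sum>i\<in>I. b i - a i) < \<delta> \<Longrightarrow>
      (\<Sum>i\<in>I. \<bar>g (b i) - g (a i)\<bar>) < \<epsilon>"
    using abs_continuous_fun_onE[OF assms(1) \<open>\<epsilon> > 0\<close>, where ?'i = nat] by blast
  define k where "k x = max u (min v x)" for x
  show "\<exists>\<delta>>0. \<forall>(I :: nat set) a b. finite I \<longrightarrow> (\<forall>i\<in>I. a i \<le> b i \<and> {a i..b i} \<subseteq> UNIV) \<longrightarrow>
      disjoint_family_on (\<lambda>i. {a i<..<b i}) I \<longrightarrow> (\<Sum>i\<in>I. b i - a i) < \<delta> \<longrightarrow>
      (\<Sum>i\<in>I. \<bar>g (max u (min v (b i))) - g (max u (min v (a i)))\<bar>) < \<epsilon>"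
    unfolding k_def[symmetric]
  proof (intro exI[of _ \<delta>] conjI allI impI)
    fix I :: "nat set" and a b
    assume I: "finite I" "\<forall>i\<in>I. a i \<le> b i \<and> {a i..b i} \<subseteq> UNIV"
      "disjoint_family_on (\<lambda>i. {a i<..<b i}) I" "(\<Sum>i\<in>I. b i - a i) < \<delta>"
    show "(\<Sum>i\<in>I. \<bar>g (k (b i)) - g (k (a i))\<bar>) < \<epsilon>"
    proof (rule \<delta>(2)[OF I(1)])
      show "k (a i) \<le> k (b i) \<and> {k (a i)..k (b i)} \<subseteq> {u..v}" if "i \<in> I" for i
        using I(2) that \<open>u \<le> v\<close> unfolding k_def by auto
      show "disjoint_family_on (\<lambda>i. {k (a i)<..<k (b i)}) I"
        unfolding k_def by (rule disjoint_family_on_subsets[OF I(3)]) auto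
      have "(\<Sum>i\<in>I. k (b i) - k (a i)) \<le> (\<Sum>i\<in>I. b i - a i)"
        using I(2) \<open>u \<le> v\<close> unfolding k_def by (intro sum_mono) auto
      then show "(\<Sum>i\<in>I. k (b i) - k (a i)) < \<delta>" using I(4) by linarith
    qed
  qed (rule \<delta>(1))
qed

text \<open>The truncations \<open>G n\<close> agree with \<open>g\<close> on
  \<open>{- n..n}\<close> and fall under the whole-line case. Their derivatives \<open>f n\<close>
  agree almost everywhere on overlaps, being derivatives of \<open>g\<close> there, and are glued to
  one function.\<close>

lemma abs_continuous_fun_derivative:
  assumes "abs_continuous_fun g"
  obtains f where "f \<in> borel_measurable borel"
    "AE x in lborel. (g has_real_derivative f x) (at x)"
    "\<And>a b. a \<le> b \<Longrightarrow> ennreal \<bar>g b - g a\<bar> \<le> (\<integral>\<^sup>+x\<in>{a..b}. ennreal \<bar>f x\<bar> \<partial>lborel)"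
proof -
  define G where "G n x = g (max (- real n) (min (real n) x))" for n x
  have Geq: "G n x = g x" if "\<bar>x\<bar> \<le> real n" for n x
    unfolding G_def using that by (auto simp: max_def min_def abs_le_iff)
  define R where "R n f \<longleftrightarrow> f \<in> borel_measurable borel \<and>
      (AE x in lborel. (G n has_real_derivative f x) (at x)) \<and>
      (\<forall>a b. a \<le> b \<longrightarrow> ennreal \<bar>G n b - G n a\<bar> \<le> (\<integral>\<^sup>+x\<in>{a..b}. ennreal \<bar>f x\<bar> \<partial>lborel))"
    for n f
  have "\<exists>f. R n f" for n
  proof -
    have "abs_continuous_fun_on UNIV (G n)"
      unfolding G_def using assms by (intro abs_continuous_fun_on_clamp) (auto simp: abs_continuous_fun_def)
    moreover have "G n x = G n (- real n)" if "x \<le> - real n" for x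
      unfolding G_def using that by (auto simp: max_def min_def)
    ultimately obtain f where "f \<in> borel_measurable borel"
      "AE x in lborel. (G n has_real_derivative f x) (at x)"
      "\<And>a b. a \<le> b \<Longrightarrow> ennreal \<bar>G n b - G n a\<bar> \<le> (\<integral>\<^sup>+x\<in>{a..b}. ennreal \<bar>f x\<bar> \<partial>lborel)"
      using abs_continuous_UNIV_derivative[of "G n" "- real n"] by blast
    then show ?thesis unfolding R_def by (intro exI[of _ f] conjI allI impI)
  qed
  then obtain f where R: "\<And>n. R n (f n)" by metis
  have f: "\<And>n. f n \<in> borel_measurable borel"
    "\<And>n. AE x in lborel. (G n has_real_derivative f n x) (at x)"
    "\<And>n a b. a \<le> b \<Longrightarrow> ennreal \<bar>G n b - G n a\<bar> \<le> (\<integral>\<^sup>+x\<in>{a..b}. ennreal \<bar>f n x\<bar> \<partial>lborel)"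
    using R unfolding R_def by blast+
  \<comment> \<open>The added 1 puts \<open>x\<close> strictly inside the interval of the chosen
    truncation even when \<open>|x|\<close> is an integer; there the derivative of the truncation is
    that of \<open>g\<close>.\<close>
  define F where "F x = f (nat \<lceil>\<bar>x\<bar>\<rceil> + 1) x" for x
  have der: "(g has_real_derivative f n x) (at x)"
    if "(G n has_real_derivative f n x) (at x)" "\<bar>x\<bar> < real n" for n x
    using that(1)
  proof (rule has_field_derivative_transform_within_open)
    show "open {- real n<..<real n}" "x \<in> {- real n<..<real n}" using that(2) by auto
  qed (auto intro!: Geq)
  have lt: "\<bar>x\<bar> < real (nat \<lceil>\<bar>x\<bar>\<rceil> + 1)" for x :: real by linarith
  have all: "AE x in lborel. \<forall>n. (G n has_real_derivative f n x) (at x)"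
    using f(2) by (simp add: AE_all_countable)
  show thesis
  proof (rule that[of F])
    note [measurable] = f(1)
    show "F \<in> borel_measurable borel"
      unfolding F_def by (rule measurable_compose_countable[where f = f]) measurable
    show "AE x in lborel. (g has_real_derivative F x) (at x)"
      using all by eventually_elim (use der lt in \<open>auto simp: F_def\<close>)
    fix a b :: real assume "a \<le> b"
    obtain n where "max \<bar>a\<bar> \<bar>b\<bar> < real n" using reals_Archimedean2 by blast
    then have n: "\<bar>a\<bar> < real n" "\<bar>b\<bar> < real n" by auto
    have "AE x in lborel. ennreal \<bar>f n x\<bar> * indicator {a..b} x = ennreal \<bar>F x\<bar> * indicator {a..b} x"
      using all
    proof eventually_elim
      case (elim x)
      have "f n x = F x" if "x \<in> {a..b}"
        using der[OF elim[rule_format], of n] der[OF elim[rule_format] lt[of x]] that n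
        unfolding F_def by (intro DERIV_unique) auto
      then show ?case by (auto split: split_indicator)
    qed
    then have "(\<integral>\<^sup>+x\<in>{a..b}. ennreal \<bar>f n x\<bar> \<partial>lborel) = (\<integral>\<^sup>+x\<in>{a..b}. ennreal \<bar>F x\<bar> \<partial>lborel)"
      by (rule nn_integral_cong_AE)
    then show "ennreal \<bar>g b - g a\<bar> \<le> (\<integral>\<^sup>+x\<in>{a..b}. ennreal \<bar>F x\<bar> \<partial>lborel)"
      using f(3)[OF \<open>a \<le> b\<close>, of n] Geq[of a n] Geq[of b n] n by simp
  qed
qed

text \<open>Near \<open>x\<close> the function agrees with its clamped version. The result is used
  for the Borel measurability of \<open>g\<close>.\<close>

lemma abs_continuous_fun_imp_continuous:
  assumes "abs_continuous_fun g"
  shows "continuous_on UNIV g"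
proof (rule continuous_at_imp_continuous_on, rule ballI)
  fix x :: real
  define G where "G t = g (max (x - 1) (min (x + 1) t))" for t
  have "abs_continuous_fun_on UNIV G"
    unfolding G_def using assms by (intro abs_continuous_fun_on_clamp) (auto simp: abs_continuous_fun_def)
  then have "isCont G x"
    using abs_continuous_imp_continuous continuous_on_eq_continuous_at open_UNIV by blast
  moreover have "eventually (\<lambda>t. G t = g t) (nhds x)"
    unfolding eventually_nhds
    by (intro exI[of _ "{x - 1<..<x + 1}"]) (auto simp: G_def max_def min_def)
  ultimately show "isCont g x"
    using isCont_cong by blast
qed

section \<open>Variance bounds by a kernel\<close>

text \<open>With an independent copy, \<open>E (U - U')\<^sup>2 = 2 Var U\<close>. Integrability of
  \<open>U\<close> has to be derived first, since \<open>ext_variance\<close> is infinite otherwise: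
  a finite double integral yields a point \<open>x0\<close> for which \<open>U x0 - U\<close> is
  square integrable.\<close>

lemma (in prob_space) ext_variance_le:
  assumes [measurable]: "U \<in> borel_measurable M" and "c < \<infinity>"
    and le: "(\<integral>\<^sup>+x. \<integral>\<^sup>+y. ennreal ((U x - U y)\<^sup>2) \<partial>M \<partial>M) \<le> 2 * c"
  shows "ext_variance M U \<le> c"
proof -
  have "AE x in M. (\<integral>\<^sup>+y. ennreal ((U x - U y)\<^sup>2) \<partial>M) \<noteq> \<infinity>"
  proof (rule nn_integral_PInf_AE)
    have "2 * c < \<infinity>" using \<open>c < \<infinity>\<close> by (simp add: ennreal_mult_less_top)
    then show "(\<integral>\<^sup>+x. \<integral>\<^sup>+y. ennreal ((U x - U y)\<^sup>2) \<partial>M \<partial>M) \<noteq> \<infinity>"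
      using le by auto
  qed measurable
  then obtain x0 where "(\<integral>\<^sup>+y. ennreal ((U x0 - U y)\<^sup>2) \<partial>M) \<noteq> \<infinity>"
    using eventually_happens'[OF ae_filter_bot] by blast
  then have sq: "integrable M (\<lambda>y. (U x0 - U y)\<^sup>2)"
    by (intro integrableI_nonneg) (auto simp: less_top)
  have "integrable M (\<lambda>y. U x0 - U y)"
    by (rule square_integrable_imp_integrable[OF _ sq]) measurable
  then have "integrable M (\<lambda>y. U x0 - (U x0 - U y))"
    by (rule Bochner_Integration.integrable_diff[OF integrable_const])
  then have int: "integrable M U" by simp
  define m where "m = expectation U"
  have "integrable M (\<lambda>y. (U x0 - U y)\<^sup>2 - 2 * (U x0 - m) * (U x0 - U y) + (U x0 - m)\<^sup>2)"
    using sq int by auto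
  also have "(\<lambda>y. (U x0 - U y)\<^sup>2 - 2 * (U x0 - m) * (U x0 - U y) + (U x0 - m)\<^sup>2) = (\<lambda>y. (U y - m)\<^sup>2)"
    by (auto simp: power2_eq_square algebra_simps)
  finally have int2: "integrable M (\<lambda>y. (U y - m)\<^sup>2)" .
  define V where "V = expectation (\<lambda>y. (U y - m)\<^sup>2)"
  have "V \<ge> 0" unfolding V_def by simp
  \<comment> \<open>The mean square distance from \<open>U x\<close> is the variance plus the
    squared distance of \<open>U x\<close> from the mean; integration over \<open>x\<close> then
    gives \<open>2 * V\<close>.\<close>
  have inner: "(\<integral>\<^sup>+y. ennreal ((U x - U y)\<^sup>2) \<partial>M) = ennreal ((U x - m)\<^sup>2) + ennreal V" for x
  proof -
    have eq: "(U x - U y)\<^sup>2 = (U x - m)\<^sup>2 - 2 * (U x - m) * (U y - m) + (U y - m)\<^sup>2" for y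
      by (simp add: power2_eq_square algebra_simps)
    have "integrable M (\<lambda>y. (U x - U y)\<^sup>2)" unfolding eq using int int2 by auto
    then have "(\<integral>\<^sup>+y. ennreal ((U x - U y)\<^sup>2) \<partial>M) = ennreal (expectation (\<lambda>y. (U x - U y)\<^sup>2))"
      by (intro nn_integral_eq_integral) auto
    also have "expectation (\<lambda>y. (U x - U y)\<^sup>2) = (U x - m)\<^sup>2 + V"
      unfolding eq V_def using int int2 by (simp add: prob_space m_def)
    finally show ?thesis using \<open>V \<ge> 0\<close> by simp
  qed
  have nV: "(\<integral>\<^sup>+x. ennreal ((U x - m)\<^sup>2) \<partial>M) = ennreal V"
    unfolding V_def using int2 by (intro nn_integral_eq_integral) auto
  have "(\<integral>\<^sup>+x. \<integral>\<^sup>+y. ennreal ((U x - U y)\<^sup>2) \<partial>M \<partial>M) = 2 * ennreal V"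
    unfolding inner by (subst nn_integral_add) (auto simp: nV emeasure_space_1 mult_2)
  then have "ennreal V \<le> c"
    using le ennreal_mult_le_mult_iff[of 2] by simp
  then show ?thesis
    unfolding ext_variance_def using int nV by (simp add: m_def)
qed

text \<open>Cauchy-Schwarz for \<open>|f|\<close> against the constant 1 on the interval, whose
  squared norm is \<open>b - a\<close>. Passing to the half-open interval, which matches
  \<open>gap_kernel\<close>, removes only a null set.\<close>

lemma square_increment_le:
  fixes f g :: "real \<Rightarrow> real"
  assumes [measurable]: "f \<in> borel_measurable borel" and "a \<le> b"
    and "ennreal \<bar>g b - g a\<bar> \<le> (\<integral>\<^sup>+s\<in>{a..b}. ennreal \<bar>f s\<bar> \<partial>lborel)"
  shows "ennreal ((g b - g a)\<^sup>2)
    \<le> (\<integral>\<^sup>+s. ennreal ((f s)\<^sup>2) * (ennreal (b - a) * indicator {a<..b} s) \<partial>lborel)"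
proof -
  have "ennreal \<bar>g b - g a\<bar> \<le> (\<integral>\<^sup>+s\<in>{a<..b}. ennreal \<bar>f s\<bar> \<partial>lborel)"
  proof -
    have "(\<integral>\<^sup>+s\<in>{a..b}. ennreal \<bar>f s\<bar> \<partial>lborel) = (\<integral>\<^sup>+s\<in>{a<..b}. ennreal \<bar>f s\<bar> \<partial>lborel)"
      using AE_lborel_singleton[of a]
      by (intro nn_integral_cong_AE) (auto elim!: eventually_mono split: split_indicator)
    then show ?thesis using assms(3) by simp
  qed
  then have "(ennreal \<bar>g b - g a\<bar>)\<^sup>2 \<le> (\<integral>\<^sup>+s. ennreal \<bar>f s\<bar> * indicator {a<..b} s \<partial>lborel)\<^sup>2"
    by (intro power_mono) auto
  \<comment> \<open>The indicator is doubled so that it stays in both factors after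
    Cauchy-Schwarz.\<close>
  also have "(\<integral>\<^sup>+s. ennreal \<bar>f s\<bar> * indicator {a<..b} s \<partial>lborel)
      = (\<integral>\<^sup>+s. (ennreal \<bar>f s\<bar> * indicator {a<..b} s) * indicator {a<..b} s \<partial>lborel)"
    by (intro nn_integral_cong) (auto split: split_indicator)
  also have "\<dots>\<^sup>2 \<le> (\<integral>\<^sup>+s. (ennreal \<bar>f s\<bar> * indicator {a<..b} s)\<^sup>2 \<partial>lborel)
      * (\<integral>\<^sup>+s. (indicator {a<..b} s)\<^sup>2 \<partial>lborel)"
    by (rule Cauchy_Schwarz_nn_integral) auto
  also have "(\<integral>\<^sup>+s. (indicator {a<..b} s)\<^sup>2 \<partial>lborel) = (\<integral>\<^sup>+s. indicator {a<..b} s \<partial>(lborel :: real measure))"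
    by (intro nn_integral_cong) (auto split: split_indicator)
  also have "\<dots> = ennreal (b - a)" using \<open>a \<le> b\<close> by simp
  also have "(\<integral>\<^sup>+s. (ennreal \<bar>f s\<bar> * indicator {a<..b} s)\<^sup>2 \<partial>lborel) * ennreal (b - a)
      = (\<integral>\<^sup>+s. (ennreal \<bar>f s\<bar> * indicator {a<..b} s)\<^sup>2 * ennreal (b - a) \<partial>lborel)"
    by (rule nn_integral_multc[symmetric]) measurable
  also have "\<dots> = (\<integral>\<^sup>+s. ennreal ((f s)\<^sup>2) * (ennreal (b - a) * indicator {a<..b} s) \<partial>lborel)"
    by (intro nn_integral_cong) (auto simp: ennreal_power split: split_indicator)
  finally show ?thesis by (simp add: ennreal_power)
qed

text \<open>Weight of the point \<open>s\<close> in the Cauchy-Schwarz bound for the pair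
  \<open>x\<close>, \<open>y\<close>. It vanishes unless \<open>y < x\<close>, so exactly one order
  of two distinct points contributes.\<close>

definition gap_kernel :: "real \<Rightarrow> real \<Rightarrow> real \<Rightarrow> ennreal" where
  "gap_kernel x y s = ennreal (x - y) * indicator {y<..x} s"

lemma measurable_gap_kernel [measurable]:
  assumes [measurable]: "u \<in> borel_measurable N" "v \<in> borel_measurable N" "w \<in> borel_measurable N"
  shows "(\<lambda>z. gap_kernel (u z) (v z) (w z)) \<in> borel_measurable N"
proof -
  \<comment> \<open>The indicator of an interval that moves with \<open>z\<close> becomes a
    comparison of measurable functions.\<close>
  have "gap_kernel (u z) (v z) (w z) = (if v z < w z \<and> w z \<le> u z then ennreal (u z - v z) else 0)" for z
    unfolding gap_kernel_def by auto
  then show ?thesis by simp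
qed

text \<open>The squared increment is bounded by the sum over both orders of the pair. Tonelli moves
  the integral over \<open>s\<close> outside, and exchanging the two copies shows that both orders
  contribute equally, whence the factor 2.\<close>

lemma double_square_increment_le:
  fixes f g :: "real \<Rightarrow> real"
  assumes "sigma_finite_measure D" and [measurable_cong]: "sets D = sets borel"
    and [measurable]: "f \<in> borel_measurable borel"
    and incr: "\<And>a b. a \<le> b \<Longrightarrow> ennreal \<bar>g b - g a\<bar> \<le> (\<integral>\<^sup>+s\<in>{a..b}. ennreal \<bar>f s\<bar> \<partial>lborel)"
  shows "(\<integral>\<^sup>+x. \<integral>\<^sup>+y. ennreal ((g x - g y)\<^sup>2) \<partial>D \<partial>D)
    \<le> 2 * (\<integral>\<^sup>+s. ennreal ((f s)\<^sup>2) * (\<integral>\<^sup>+x. \<integral>\<^sup>+y. gap_kernel x y s \<partial>D \<partial>D) \<partial>lborel)"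
proof -
  interpret D: sigma_finite_measure D by fact
  interpret DD: pair_sigma_finite D D ..
  interpret DL: pair_sigma_finite D "lborel :: real measure" ..
  define J where "J = (\<integral>\<^sup>+s. ennreal ((f s)\<^sup>2) * (\<integral>\<^sup>+x. \<integral>\<^sup>+y. gap_kernel x y s \<partial>D \<partial>D) \<partial>lborel)"
  have pt: "ennreal ((g x - g y)\<^sup>2) \<le> (\<integral>\<^sup>+s. ennreal ((f s)\<^sup>2) * gap_kernel x y s \<partial>lborel)
      + (\<integral>\<^sup>+s. ennreal ((f s)\<^sup>2) * gap_kernel y x s \<partial>lborel)" for x y
  proof (cases "y \<le> x")
    case True
    then show ?thesis
      using square_increment_le[OF assms(3) True incr[OF True]]
      unfolding gap_kernel_def by (simp add: add_increasing2)
  next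
    case False
    then have "x \<le> y" by simp
    then show ?thesis
      using square_increment_le[OF assms(3) \<open>x \<le> y\<close> incr[OF \<open>x \<le> y\<close>]]
      unfolding gap_kernel_def by (simp add: add_increasing power2_commute)
  qed
  have 1: "(\<integral>\<^sup>+x. \<integral>\<^sup>+y. \<integral>\<^sup>+s. ennreal ((f s)\<^sup>2) * gap_kernel x y s \<partial>lborel \<partial>D \<partial>D) = J"
  proof -
    have "(\<integral>\<^sup>+x. \<integral>\<^sup>+y. \<integral>\<^sup>+s. ennreal ((f s)\<^sup>2) * gap_kernel x y s \<partial>lborel \<partial>D \<partial>D)
        = (\<integral>\<^sup>+x. \<integral>\<^sup>+s. \<integral>\<^sup>+y. ennreal ((f s)\<^sup>2) * gap_kernel x y s \<partial>D \<partial>lborel \<partial>D)"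
      by (intro nn_integral_cong DL.Fubini'[symmetric]) measurable
    also have "\<dots> = (\<integral>\<^sup>+s. \<integral>\<^sup>+x. \<integral>\<^sup>+y. ennreal ((f s)\<^sup>2) * gap_kernel x y s \<partial>D \<partial>D \<partial>lborel)"
      by (intro DL.Fubini'[symmetric]) measurable
    also have "\<dots> = J"
      unfolding J_def by (intro nn_integral_cong) (simp add: nn_integral_cmult)
    finally show ?thesis .
  qed
  have 2: "(\<integral>\<^sup>+x. \<integral>\<^sup>+y. \<integral>\<^sup>+s. ennreal ((f s)\<^sup>2) * gap_kernel y x s \<partial>lborel \<partial>D \<partial>D) = J"
    unfolding 1[symmetric] by (intro DD.Fubini') measurable
  have "(\<integral>\<^sup>+x. \<integral>\<^sup>+y. ennreal ((g x - g y)\<^sup>2) \<partial>D \<partial>D)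
      \<le> (\<integral>\<^sup>+x. \<integral>\<^sup>+y. (\<integral>\<^sup>+s. ennreal ((f s)\<^sup>2) * gap_kernel x y s \<partial>lborel)
      + (\<integral>\<^sup>+s. ennreal ((f s)\<^sup>2) * gap_kernel y x s \<partial>lborel) \<partial>D \<partial>D)"
    by (intro nn_integral_mono pt)
  also have "\<dots> = (\<integral>\<^sup>+x. (\<integral>\<^sup>+y. \<integral>\<^sup>+s. ennreal ((f s)\<^sup>2) * gap_kernel x y s \<partial>lborel \<partial>D)
      + (\<integral>\<^sup>+y. \<integral>\<^sup>+s. ennreal ((f s)\<^sup>2) * gap_kernel y x s \<partial>lborel \<partial>D) \<partial>D)"
    by (intro nn_integral_cong nn_integral_add) measurable
  also have "\<dots> = J + J"
    unfolding 1[symmetric] by (subst nn_integral_add) (measurable, simp add: 1 2)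
  finally show ?thesis unfolding J_def by (simp add: mult_2)
qed

text \<open>For \<open>y < s \<le> x\<close> the gap splits as \<open>(x - s) + (s - y)\<close>,
  which separates the variables. With \<open>A\<close> and \<open>A'\<close> the mean excesses above
  and below \<open>s\<close> and \<open>B\<close> the mass of \<open>{s..}\<close>, the double
  integral is \<open>A * (1 - B) + B * A'\<close>, and \<open>A - A'\<close> is the mean minus
  \<open>s\<close>.\<close>

lemma nn_integral_gap_kernel:
  fixes M :: "real measure"
  assumes "prob_space M" and [measurable_cong]: "sets M = sets borel" and int: "integrable M (\<lambda>x. x)"
  shows "(\<integral>\<^sup>+x. \<integral>\<^sup>+y. gap_kernel x y s \<partial>M \<partial>M) =
    ennreal ((\<integral>x. max (x - s) 0 \<partial>M) + measure M {s..} * (s - (\<integral>x. x \<partial>M)))"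
proof -
  interpret prob_space M by fact
  have [simp]: "space M = UNIV" using sets_eq_imp_space_eq[OF assms(2)] by simp
  have [measurable]: "{s..} \<in> sets M" "{..<s} \<in> sets M" by (simp_all add: assms(2))
  define A B where "A = expectation (\<lambda>x. max (x - s) 0)" and "B = prob {s..}"
  define A' where "A' = expectation (\<lambda>x. max (s - x) 0)"
  have intA: "integrable M (\<lambda>x. max (x - s) 0)" "integrable M (\<lambda>x. max (s - x) 0)"
    using int by auto
  have nn: "A \<ge> 0" "A' \<ge> 0" "B \<ge> 0" "B \<le> 1" unfolding A_def A'_def B_def by auto
  have "A - A' = expectation (\<lambda>x. max (x - s) 0 - max (s - x) 0)"
    unfolding A_def A'_def using intA by simp
  also have "(\<lambda>x. max (x - s) 0 - max (s - x) 0) = (\<lambda>x. x - s)" by auto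
  also have "expectation (\<lambda>x. x - s) = expectation (\<lambda>x. x) - s"
    using int prob_space by simp
  finally have A': "A' = A - (expectation (\<lambda>x. x) - s)" by simp
  have "prob {..<s} = 1 - B"
  proof -
    have "{..<s} = space M - {s..}" by auto
    then show ?thesis unfolding B_def by (simp only: prob_compl[OF \<open>{s..} \<in> sets M\<close>])
  qed
  then have e: "emeasure M {..<s} = ennreal (1 - B)" "emeasure M {s..} = ennreal B"
    by (simp_all add: emeasure_eq_measure B_def)
  have k: "gap_kernel x y s = ennreal (max (x - s) 0) * indicator {..<s} y + indicator {s..} x * ennreal (max (s - y) 0)" for x y
  proof -
    consider "y < s" "s \<le> x" | "y < s" "x < s" | "s \<le> y" "s \<le> x" | "s \<le> y" "x < s" by linarith
    then show ?thesis
    proof cases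
      case 1
      then have "ennreal (x - y) = ennreal (x - s) + ennreal (s - y)"
        by (subst ennreal_plus[symmetric]) auto
      then show ?thesis using 1 unfolding gap_kernel_def by simp
    qed (auto simp: gap_kernel_def ennreal_neg)
  qed
  have "(\<integral>\<^sup>+y. gap_kernel x y s \<partial>M) = ennreal (max (x - s) 0) * ennreal (1 - B) + indicator {s..} x * ennreal A'" for x
  proof -
    have "(\<integral>\<^sup>+y. ennreal (max (s - y) 0) \<partial>M) = ennreal A'"
      unfolding A'_def using intA by (intro nn_integral_eq_integral) auto
    then show ?thesis unfolding k by (simp add: nn_integral_add nn_integral_cmult e)
  qed
  moreover have "(\<integral>\<^sup>+x. ennreal (max (x - s) 0) \<partial>M) = ennreal A"
    unfolding A_def using intA by (intro nn_integral_eq_integral) auto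
  ultimately have "(\<integral>\<^sup>+x. \<integral>\<^sup>+y. gap_kernel x y s \<partial>M \<partial>M) = ennreal A * ennreal (1 - B) + ennreal B * ennreal A'"
    by (simp add: nn_integral_add nn_integral_multc e)
  also have "\<dots> = ennreal (A * (1 - B) + B * A')"
    using nn by (simp add: ennreal_mult)
  also have "A * (1 - B) + B * A' = A + B * (s - expectation (\<lambda>x. x))"
    unfolding A' by (simp add: algebra_simps)
  finally show ?thesis unfolding A_def B_def .
qed

text \<open>The left side of the kernel hypothesis is the gap kernel averaged over two independent
  copies of \<open>Y\<close>. Bounding it by \<open>C\<close> times the density turns the integral
  against the squared derivative of \<open>g\<close> into at most \<open>C\<close> times the
  energy.\<close>

lemma (in prob_space) poincare_constant_le:
  fixes Y :: "'a \<Rightarrow> real" and f :: "real \<Rightarrow> real"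
  assumes Y: "distributed M lborel Y f" and int: "integrable M Y" and "C \<ge> 0"
    and kernel: "\<And>s. expectation (\<lambda>\<omega>. max (Y \<omega> - s) 0)
      + prob {\<omega> \<in> space M. s \<le> Y \<omega>} * (s - expectation Y) \<le> C * f s"
  shows "poincare_constant M Y \<le> ennreal C"
  unfolding poincare_constant_def
proof (rule SUP_least)
  fix g assume "g \<in> H1 M Y"
  then have g: "abs_continuous_fun g" and pos: "ext_variance M (\<lambda>\<omega>. g (Y \<omega>)) > 0"
    and fin: "energy M Y g < \<infinity>"
    unfolding H1_def by auto
  have Ym [measurable]: "Y \<in> borel_measurable M"
    using int by (rule borel_measurable_integrable)
  have fm [measurable]: "(\<lambda>s. ennreal (f s)) \<in> borel_measurable borel"
    using distributed_borel_measurable[OF Y] by simp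
  have gm [measurable]: "g \<in> borel_measurable borel"
    using abs_continuous_fun_imp_continuous[OF g] by (rule borel_measurable_continuous_onI)
  obtain F where Fm [measurable]: "F \<in> borel_measurable borel"
    and F: "AE x in lborel. (g has_real_derivative F x) (at x)"
    and incr: "\<And>a b. a \<le> b \<Longrightarrow> ennreal \<bar>g b - g a\<bar> \<le> (\<integral>\<^sup>+x\<in>{a..b}. ennreal \<bar>F x\<bar> \<partial>lborel)"
    using abs_continuous_fun_derivative[OF g] by blast
  define D where "D = distr M borel Y"
  have D: "D = density lborel (\<lambda>s. ennreal (f s))"
  proof -
    have "D = distr M lborel Y" unfolding D_def by (rule distr_cong) auto
    then show ?thesis using distributed_distr_eq_density[OF Y] by simp
  qed
  interpret D: prob_space D unfolding D_def by (rule prob_space_distr) measurable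
  have setsD [measurable_cong]: "sets D = sets borel" unfolding D_def by simp
  have intD: "integrable D (\<lambda>x. x)"
    unfolding D_def using int by (simp add: integrable_distr_eq)
  have \<kappa>: "(\<integral>\<^sup>+x. \<integral>\<^sup>+y. gap_kernel x y s \<partial>D \<partial>D) \<le> ennreal (C * f s)" for s
  proof -
    have 1: "(\<integral>x. max (x - s) 0 \<partial>D) = expectation (\<lambda>\<omega>. max (Y \<omega> - s) 0)"
      unfolding D_def by (rule integral_distr) measurable
    have 2: "(\<integral>x. x \<partial>D) = expectation Y"
      unfolding D_def by (rule integral_distr) measurable
    have 3: "measure D {s..} = prob {\<omega> \<in> space M. s \<le> Y \<omega>}"
      unfolding D_def by (subst measure_distr) (auto simp: vimage_def Int_def conj_commute)
    show ?thesis
      unfolding nn_integral_gap_kernel[OF D.prob_space_axioms setsD intD] 1 2 3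
      by (rule ennreal_leI[OF kernel])
  qed
  \<comment> \<open>Lebesgue null sets are null for the law of \<open>Y\<close>, which has a
    density; hence \<open>deriv g\<close> may be replaced by the measurable
    \<open>F\<close>.\<close>
  have "AE x in D. deriv g x = F x"
  proof -
    have "AE x in lborel. deriv g x = F x"
      using F by eventually_elim (rule DERIV_imp_deriv)
    then have "AE x in lborel. 0 < ennreal (f x) \<longrightarrow> deriv g x = F x"
      by eventually_elim simp
    then show ?thesis unfolding D using fm by (subst AE_density) simp_all
  qed
  then have "AE \<omega> in M. deriv g (Y \<omega>) = F (Y \<omega>)"
    unfolding D_def by (rule AE_distrD[OF Ym])
  then have energy: "energy M Y g = (\<integral>\<^sup>+\<omega>. ennreal ((F (Y \<omega>))\<^sup>2) \<partial>M)"
    unfolding energy_def by (intro nn_integral_cong_AE) auto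
  have "(\<integral>\<^sup>+\<omega>. \<integral>\<^sup>+\<omega>'. ennreal ((g (Y \<omega>) - g (Y \<omega>'))\<^sup>2) \<partial>M \<partial>M)
      = (\<integral>\<^sup>+x. \<integral>\<^sup>+y. ennreal ((g x - g y)\<^sup>2) \<partial>D \<partial>D)"
    unfolding D_def by (simp add: nn_integral_distr)
  also have "\<dots> \<le> 2 * (\<integral>\<^sup>+s. ennreal ((F s)\<^sup>2) * (\<integral>\<^sup>+x. \<integral>\<^sup>+y. gap_kernel x y s \<partial>D \<partial>D) \<partial>lborel)"
    by (rule double_square_increment_le[OF D.sigma_finite_measure_axioms setsD Fm incr])
  also have "\<dots> \<le> 2 * (\<integral>\<^sup>+s. ennreal C * (ennreal (f s) * ennreal ((F s)\<^sup>2)) \<partial>lborel)"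
  proof (intro mult_left_mono nn_integral_mono)
    fix s
    have "ennreal ((F s)\<^sup>2) * (\<integral>\<^sup>+x. \<integral>\<^sup>+y. gap_kernel x y s \<partial>D \<partial>D) \<le> ennreal ((F s)\<^sup>2) * ennreal (C * f s)"
      by (intro mult_left_mono \<kappa>) simp
    also have "ennreal (C * f s) = ennreal C * ennreal (f s)"
      using \<open>C \<ge> 0\<close> by (rule ennreal_mult')
    finally show "ennreal ((F s)\<^sup>2) * (\<integral>\<^sup>+x. \<integral>\<^sup>+y. gap_kernel x y s \<partial>D \<partial>D)
        \<le> ennreal C * (ennreal (f s) * ennreal ((F s)\<^sup>2))"
      by (simp add: mult_ac)
  qed simp
  also have "(\<integral>\<^sup>+s. ennreal C * (ennreal (f s) * ennreal ((F s)\<^sup>2)) \<partial>lborel)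
      = ennreal C * (\<integral>\<^sup>+s. ennreal ((F s)\<^sup>2) \<partial>D)"
    unfolding D by (simp add: nn_integral_cmult nn_integral_density)
  also have "(\<integral>\<^sup>+s. ennreal ((F s)\<^sup>2) \<partial>D) = energy M Y g"
    unfolding energy D_def by (rule nn_integral_distr) measurable
  finally have "(\<integral>\<^sup>+\<omega>. \<integral>\<^sup>+\<omega>'. ennreal ((g (Y \<omega>) - g (Y \<omega>'))\<^sup>2) \<partial>M \<partial>M) \<le> 2 * (ennreal C * energy M Y g)" .
  \<comment> \<open>Membership in \<open>H1\<close> makes the bound finite, as
    \<open>ext_variance_le\<close> requires.\<close>
  moreover have "ennreal C * energy M Y g < \<infinity>"
    using fin by (simp add: ennreal_mult_less_top)
  ultimately have le: "ext_variance M (\<lambda>\<omega>. g (Y \<omega>)) \<le> ennreal C * energy M Y g"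
    by (intro ext_variance_le) measurable
  \<comment> \<open>Zero energy would force zero variance, which \<open>H1\<close> excludes, so the
    quotient may be bounded by cross-multiplication.\<close>
  then have "energy M Y g > 0"
    using pos by (cases "energy M Y g = 0") (auto simp: zero_less_iff_neq_zero)
  then show "ext_variance M (\<lambda>\<omega>. g (Y \<omega>)) / energy M Y g \<le> ennreal C"
    using le by (intro divide_le_posI_ennreal) (simp_all add: mult.commute)
qed

section \<open>Normal mixtures\<close>

text \<open>For weights of total mass 1 both sides are twice the covariance of \<open>x\<close> and
  \<open>Q\<close>: the left side uses an independent copy, the right side centring.\<close>

lemma weighted_covariance_eq:
  fixes p x Q :: "'i \<Rightarrow> real"
  assumes "finite I" "(\<Sum>i\<in>I. p i) = 1" "\<mu> = (\<Sum>i\<in>I. p i * x i)"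
  shows "(\<Sum>i\<in>I. \<Sum>j\<in>I. p i * p j * ((x i - x j) * (Q i - Q j))) = 2 * (\<Sum>i\<in>I. p i * (x i - \<mu>) * Q i)"
proof -
  have "(\<Sum>i\<in>I. \<Sum>j\<in>I. p i * p j * ((x i - x j) * (Q i - Q j)))
      = (\<Sum>i\<in>I. \<Sum>j\<in>I. p i * x i * Q i * p j - p i * x i * (p j * Q j) - p i * Q i * (p j * x j) + p i * (p j * x j * Q j))"
    by (simp add: algebra_simps)
  also have "\<dots> = (\<Sum>i\<in>I. p i * x i * Q i - p i * x i * (\<Sum>j\<in>I. p j * Q j) - p i * Q i * \<mu>
      + p i * (\<Sum>j\<in>I. p j * x j * Q j))"
    using assms by (simp add: sum.distrib sum_subtractf sum_distrib_left[symmetric])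
  also have "\<dots> = (\<Sum>i\<in>I. p i * x i * Q i) - \<mu> * (\<Sum>j\<in>I. p j * Q j) - (\<Sum>i\<in>I. p i * Q i) * \<mu>
      + (\<Sum>j\<in>I. p j * x j * Q j)"
    using assms by (simp add: sum.distrib sum_subtractf sum_distrib_right[symmetric])
  also have "\<dots> = 2 * ((\<Sum>i\<in>I. p i * x i * Q i) - (\<Sum>i\<in>I. p i * \<mu> * Q i))"
    by (simp add: sum_distrib_left sum_distrib_right algebra_simps)
  also have "\<dots> = 2 * (\<Sum>i\<in>I. p i * (x i - \<mu>) * Q i)"
    by (simp add: sum_subtractf[symmetric] algebra_simps)
  finally show ?thesis .
qed

text \<open>Bias-variance decomposition; the cross term drops out because \<open>\<mu>\<close> is
  the mean.\<close>

lemma weighted_deviation_eq: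
  fixes p x :: "'i \<Rightarrow> real"
  assumes "(\<Sum>i\<in>I. p i) = 1" "\<mu> = (\<Sum>i\<in>I. p i * x i)"
  shows "(\<Sum>j\<in>I. p j * (c - x j)\<^sup>2) = (\<Sum>j\<in>I. p j * (x j - \<mu>)\<^sup>2) + (c - \<mu>)\<^sup>2"
proof -
  have "(\<Sum>j\<in>I. p j * (c - x j)\<^sup>2)
      = (\<Sum>j\<in>I. p j * (x j - \<mu>)\<^sup>2 + p j * (c - \<mu>)\<^sup>2 - 2 * (c - \<mu>) * (p j * x j) + 2 * (c - \<mu>) * \<mu> * p j)"
    by (simp add: power2_eq_square algebra_simps)
  also have "\<dots> = (\<Sum>j\<in>I. p j * (x j - \<mu>)\<^sup>2) + (\<Sum>j\<in>I. p j) * (c - \<mu>)\<^sup>2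
      - 2 * (c - \<mu>) * (\<Sum>j\<in>I. p j * x j) + 2 * (c - \<mu>) * \<mu> * (\<Sum>j\<in>I. p j)"
    by (simp add: sum.distrib sum_subtractf sum_distrib_left sum_distrib_right)
  finally show ?thesis using assms by simp
qed

text \<open>The sum is symmetrised over pairs. The lower bound \<open>m\<close> of the weights
  enters twice: \<open>(x i - x j)\<^sup>2 \<le> 2 * v / m\<close> makes the exponential factor
  uniform, and \<open>v + (x i - \<mu>)\<^sup>2 \<le> 2 * v / m\<close> bounds the remaining sum
  over \<open>j\<close>.\<close>

lemma weighted_tail_bound:
  fixes p x Q \<phi> :: "'i \<Rightarrow> real"
  assumes I: "finite I" and p: "\<And>i. i \<in> I \<Longrightarrow> m \<le> p i" "m > 0" "(\<Sum>i\<in>I. p i) = 1"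
    and \<mu>: "\<mu> = (\<Sum>i\<in>I. p i * x i)" and v: "v = (\<Sum>i\<in>I. p i * (x i - \<mu>)\<^sup>2)"
    and "\<tau> > 0" and \<phi>: "\<And>i. i \<in> I \<Longrightarrow> 0 \<le> \<phi> i"
    and Q: "\<And>i j. i \<in> I \<Longrightarrow> j \<in> I \<Longrightarrow>
      (x i - x j) * (Q i - Q j) \<le> (x i - x j)\<^sup>2 * exp ((x i - x j)\<^sup>2 / (8 * \<tau>)) * ((\<phi> i + \<phi> j) / 2)"
  shows "(\<Sum>i\<in>I. p i * (x i - \<mu>) * Q i) \<le> v / m * exp (v / (\<tau> * m)) * (\<Sum>i\<in>I. p i * \<phi> i)"
proof -
  have p0: "0 \<le> p i" if "i \<in> I" for i using p(1)[OF that] p(2) by simp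
  have "v \<ge> 0" unfolding v using p0 by (intro sum_nonneg) auto
  have dev: "m * (x i - \<mu>)\<^sup>2 \<le> v" if "i \<in> I" for i
  proof -
    have "m * (x i - \<mu>)\<^sup>2 \<le> p i * (x i - \<mu>)\<^sup>2" using p(1)[OF that] by (simp add: mult_right_mono)
    also have "\<dots> \<le> v" unfolding v using I that p0 by (intro member_le_sum) auto
    finally show ?thesis .
  qed
  have pair: "m * (x i - x j)\<^sup>2 \<le> 2 * v" if "i \<in> I" "j \<in> I" for i j
  proof (cases "i = j")
    case False
    have "m * (x i - x j)\<^sup>2 \<le> 2 * (m * (x i - \<mu>)\<^sup>2 + m * (x j - \<mu>)\<^sup>2)"
    proof -
      \<comment> \<open>Parallelogram law, giving
        \<open>(a - b)\<^sup>2 \<le> 2 * (a\<^sup>2 + b\<^sup>2)\<close>.\<close>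
      have "(x i - x j)\<^sup>2 + ((x i - \<mu>) + (x j - \<mu>))\<^sup>2 = 2 * ((x i - \<mu>)\<^sup>2 + (x j - \<mu>)\<^sup>2)"
        by (simp add: power2_eq_square algebra_simps)
      then have "(x i - x j)\<^sup>2 \<le> 2 * ((x i - \<mu>)\<^sup>2 + (x j - \<mu>)\<^sup>2)"
        using zero_le_power2[of "(x i - \<mu>) + (x j - \<mu>)"] by linarith
      then have "m * (x i - x j)\<^sup>2 \<le> m * (2 * ((x i - \<mu>)\<^sup>2 + (x j - \<mu>)\<^sup>2))"
        using p(2) by (intro mult_left_mono) auto
      then show ?thesis by (simp add: algebra_simps)
    qed
    \<comment> \<open>Two distinct indices contribute separately to \<open>v\<close>; bounding each
      deviation by \<open>v\<close> alone would lose a factor 2.\<close>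
    also have "m * (x i - \<mu>)\<^sup>2 + m * (x j - \<mu>)\<^sup>2 \<le> (\<Sum>k\<in>{i, j}. p k * (x k - \<mu>)\<^sup>2)"
      using False p(1) that by (simp add: add_mono mult_right_mono)
    also have "\<dots> \<le> v" unfolding v using I that p0 by (intro sum_mono2) auto
    finally show ?thesis by simp
  qed (use \<open>v \<ge> 0\<close> in simp)
  define E where "E = exp (v / (\<tau> * m))"
  have E: "exp ((x i - x j)\<^sup>2 / (8 * \<tau>)) \<le> E" if "i \<in> I" "j \<in> I" for i j
  proof -
    have "(x i - x j)\<^sup>2 / (8 * \<tau>) \<le> (2 * v / m) / (8 * \<tau>)"
      using pair[OF that] p(2) \<open>\<tau> > 0\<close> by (intro divide_right_mono) (auto simp: field_simps)
    also have "\<dots> = (v / (\<tau> * m)) / 4" using p(2) \<open>\<tau> > 0\<close> by (simp add: field_simps)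
    \<comment> \<open>The exponent has a factor 4 to spare, which is given up to reach the stated
      form.\<close>
    also have "\<dots> \<le> v / (\<tau> * m)"
    proof -
      have quarter: "w / 4 \<le> w" if "0 \<le> w" for w :: real using that by simp
      show ?thesis by (rule quarter) (use \<open>v \<ge> 0\<close> p(2) \<open>\<tau> > 0\<close> in simp)
    qed
    finally show ?thesis unfolding E_def by simp
  qed
  \<comment> \<open>This bounds \<open>v\<close> by \<open>v / m\<close>, so that both parts of the
    sum over \<open>j\<close> take the same form.\<close>
  have "m \<le> 1"
  proof -
    obtain i where i: "i \<in> I" using p(3) by fastforce
    have "m \<le> p i" using p(1) i by simp
    also have "\<dots> \<le> (\<Sum>i\<in>I. p i)" using I i p0 by (intro member_le_sum) auto
    finally show ?thesis using p(3) by simp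
  qed
  have col: "(\<Sum>j\<in>I. p j * (x i - x j)\<^sup>2) \<le> 2 * (v / m)" if "i \<in> I" for i
  proof -
    have "(\<Sum>j\<in>I. p j * (x i - x j)\<^sup>2) = v + (x i - \<mu>)\<^sup>2"
      unfolding v using p(3) \<mu> by (rule weighted_deviation_eq)
    also have "v \<le> v / m" using \<open>v \<ge> 0\<close> \<open>m \<le> 1\<close> p(2) by (simp add: field_simps mult_left_le_one_le)
    also have "(x i - \<mu>)\<^sup>2 \<le> v / m" using dev[OF that] p(2) by (simp add: field_simps)
    finally show ?thesis by simp
  qed
  have "2 * (\<Sum>i\<in>I. p i * (x i - \<mu>) * Q i) = (\<Sum>i\<in>I. \<Sum>j\<in>I. p i * p j * ((x i - x j) * (Q i - Q j)))"
    using weighted_covariance_eq[OF I p(3) \<mu>] by simp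
  also have "\<dots> \<le> (\<Sum>i\<in>I. \<Sum>j\<in>I. p i * p j * ((x i - x j)\<^sup>2 * E * ((\<phi> i + \<phi> j) / 2)))"
  proof (intro sum_mono mult_left_mono)
    fix i j assume ij: "i \<in> I" "j \<in> I"
    note Q[OF ij]
    also have "(x i - x j)\<^sup>2 * exp ((x i - x j)\<^sup>2 / (8 * \<tau>)) * ((\<phi> i + \<phi> j) / 2) \<le> (x i - x j)\<^sup>2 * E * ((\<phi> i + \<phi> j) / 2)"
      using E[OF ij] \<phi> ij by (intro mult_right_mono mult_left_mono) auto
    finally show "(x i - x j) * (Q i - Q j) \<le> (x i - x j)\<^sup>2 * E * ((\<phi> i + \<phi> j) / 2)" .
  qed (use p0 in auto)
  \<comment> \<open>The average of \<open>\<phi> i\<close> and \<open>\<phi> j\<close> splits the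
    sum into two halves that agree after exchanging the indices.\<close>
  also have "\<dots> = E / 2 * ((\<Sum>i\<in>I. \<Sum>j\<in>I. p i * \<phi> i * (p j * (x i - x j)\<^sup>2))
      + (\<Sum>i\<in>I. \<Sum>j\<in>I. p j * \<phi> j * (p i * (x j - x i)\<^sup>2)))"
  proof -
    have eq: "p i * p j * ((x i - x j)\<^sup>2 * E * ((\<phi> i + \<phi> j) / 2))
        = E / 2 * (p i * \<phi> i * (p j * (x i - x j)\<^sup>2) + p j * \<phi> j * (p i * (x j - x i)\<^sup>2))" for i j
      unfolding power2_commute[of "x j" "x i"] by (simp add: field_simps)
    show ?thesis unfolding eq by (simp only: sum_distrib_left[symmetric] sum.distrib)
  qed
  also have "(\<Sum>i\<in>I. \<Sum>j\<in>I. p j * \<phi> j * (p i * (x j - x i)\<^sup>2)) = (\<Sum>i\<in>I. \<Sum>j\<in>I. p i * \<phi> i * (p j * (x i - x j)\<^sup>2))"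
    by (rule sum.swap)
  also have "E / 2 * ((\<Sum>i\<in>I. \<Sum>j\<in>I. p i * \<phi> i * (p j * (x i - x j)\<^sup>2)) + (\<Sum>i\<in>I. \<Sum>j\<in>I. p i * \<phi> i * (p j * (x i - x j)\<^sup>2)))
      = E * (\<Sum>i\<in>I. p i * \<phi> i * (\<Sum>j\<in>I. p j * (x i - x j)\<^sup>2))"
    by (simp add: sum_distrib_left mult.assoc)
  also have "\<dots> \<le> E * (\<Sum>i\<in>I. p i * \<phi> i * (2 * (v / m)))"
    using col p0 \<phi> unfolding E_def by (intro mult_left_mono sum_mono) auto
  also have "\<dots> = 2 * (v / m * E * (\<Sum>i\<in>I. p i * \<phi> i))"
    by (simp add: sum_distrib_left sum_distrib_right algebra_simps)
  finally show ?thesis unfolding E_def by simp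
qed

text \<open>The exponent is quadratic, so convexity of \<open>exp\<close> bounds the density by its chord up to the
  factor \<open>exp (l (1 - l) (v - u)\<^sup>2 / (2 \<tau>))\<close>, and \<open>l (1 - l) \<le> 1/4\<close>.\<close>

lemma normal_density_le_chord:
  assumes "\<tau> > 0" "0 \<le> l" "l \<le> 1"
  shows "normal_density 0 (sqrt \<tau>) ((1 - l) * u + l * v) \<le> exp ((v - u)\<^sup>2 / (8 * \<tau>)) *
    ((1 - l) * normal_density 0 (sqrt \<tau>) u + l * normal_density 0 (sqrt \<tau>) v)"
proof -
  have eq: "- ((1 - l) * u + l * v)\<^sup>2 / (2 * \<tau>) =
      l * (1 - l) * ((v - u)\<^sup>2 / (2 * \<tau>)) + ((1 - l) * (- u\<^sup>2 / (2 * \<tau>)) + l * (- v\<^sup>2 / (2 * \<tau>)))"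
    using \<open>\<tau> > 0\<close> by (simp add: field_simps power2_eq_square)
  have "l * (1 - l) \<le> 1 / 4"
    using zero_le_power2[of "l - 1 / 2"] by (simp add: power2_eq_square algebra_simps)
  then have "l * (1 - l) * ((v - u)\<^sup>2 / (2 * \<tau>)) \<le> 1 / 4 * ((v - u)\<^sup>2 / (2 * \<tau>))"
    using \<open>\<tau> > 0\<close> by (intro mult_right_mono) auto
  also have "\<dots> = (v - u)\<^sup>2 / (8 * \<tau>)" by simp
  finally have 1: "exp (l * (1 - l) * ((v - u)\<^sup>2 / (2 * \<tau>))) \<le> exp ((v - u)\<^sup>2 / (8 * \<tau>))" by simp
  have "exp ((1 - l) *\<^sub>R (- u\<^sup>2 / (2 * \<tau>)) + l *\<^sub>R (- v\<^sup>2 / (2 * \<tau>)))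
      \<le> (1 - l) * exp (- u\<^sup>2 / (2 * \<tau>)) + l * exp (- v\<^sup>2 / (2 * \<tau>))"
    using assms by (intro convex_onD[OF exp_convex]) auto
  then have 2: "exp ((1 - l) * (- u\<^sup>2 / (2 * \<tau>)) + l * (- v\<^sup>2 / (2 * \<tau>)))
      \<le> (1 - l) * exp (- u\<^sup>2 / (2 * \<tau>)) + l * exp (- v\<^sup>2 / (2 * \<tau>))"
    by simp
  have "exp (- ((1 - l) * u + l * v)\<^sup>2 / (2 * \<tau>))
      \<le> exp ((v - u)\<^sup>2 / (8 * \<tau>)) * ((1 - l) * exp (- u\<^sup>2 / (2 * \<tau>)) + l * exp (- v\<^sup>2 / (2 * \<tau>)))"
    unfolding eq exp_add[of "l * (1 - l) * _"] by (intro mult_mono 1 2) auto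
  moreover have density: "normal_density 0 (sqrt \<tau>) z = 1 / sqrt (2 * pi * \<tau>) * exp (- z\<^sup>2 / (2 * \<tau>))" for z
    using \<open>\<tau> > 0\<close> by (simp add: normal_density_def)
  \<comment> \<open>Restores the normalising factor of the density, common to both sides.\<close>
  moreover have scale: "k * a \<le> c * ((1 - l) * (k * b) + l * (k * d))"
    if "a \<le> c * ((1 - l) * b + l * d)" "k \<ge> 0" for a b c d k :: real
    using mult_left_mono[OF that] by (simp add: algebra_simps)
  ultimately show ?thesis
    unfolding density using \<open>\<tau> > 0\<close> by (intro scale) auto
qed

section \<open>Normal tails and mean excesses\<close>

definition normal_tail :: "real \<Rightarrow> real \<Rightarrow> real" where
  "normal_tail \<tau> t = measure (density lborel (normal_density 0 (sqrt \<tau>))) {t..}"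

text \<open>The tail difference is at most the normal mass of \<open>{u..v}\<close>. There the
  density lies below an affine function whose end values are the densities at \<open>u\<close> and
  \<open>v\<close> times the exponential factor; the claimed bound is the area of that
  trapezoid.\<close>

lemma normal_tail_diff_le:
  assumes "\<tau> > 0" "u < v"
  shows "normal_tail \<tau> u - normal_tail \<tau> v \<le> (v - u) * exp ((v - u)\<^sup>2 / (8 * \<tau>)) *
    ((normal_density 0 (sqrt \<tau>) u + normal_density 0 (sqrt \<tau>) v) / 2)"
proof -
  let ?\<phi> = "normal_density 0 (sqrt \<tau>)"
  define C where "C = exp ((v - u)\<^sup>2 / (8 * \<tau>))"
  interpret N: prob_space "density lborel ?\<phi>"
    using \<open>\<tau> > 0\<close> by (intro prob_space_normal_density) auto
  \<comment> \<open>The coefficients are chosen so that \<open>h u = C * ?\<phi> u\<close> and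
    \<open>h v = C * ?\<phi> v\<close>. \<open>H\<close> is an antiderivative of \<open>h\<close>,
    written so that one square vanishes at each end.\<close>
  define \<alpha> \<beta> where "\<alpha> = C * ?\<phi> u / (v - u)" and "\<beta> = C * ?\<phi> v / (v - u)"
  define h where "h z = \<alpha> * (v - z) + \<beta> * (z - u)" for z
  define H where "H z = - \<alpha> * (v - z)\<^sup>2 / 2 + \<beta> * (z - u)\<^sup>2 / 2" for z
  have "C > 0" unfolding C_def by simp
  then have "\<alpha> \<ge> 0" "\<beta> \<ge> 0" unfolding \<alpha>_def \<beta>_def using \<open>u < v\<close> by auto
  have h0: "0 \<le> h z" if "u \<le> z" "z \<le> v" for z
    unfolding h_def using that \<open>\<alpha> \<ge> 0\<close> \<open>\<beta> \<ge> 0\<close> by simp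
  have le: "?\<phi> z \<le> h z" if "u \<le> z" "z \<le> v" for z
  proof -
    define l where "l = (z - u) / (v - u)"
    have l: "0 \<le> l" "l \<le> 1" using that \<open>u < v\<close> by (simp_all add: l_def field_simps)
    have l1: "1 - l = (v - z) / (v - u)" using \<open>u < v\<close> by (simp add: l_def field_simps)
    have "l * (v - u) = z - u" using \<open>u < v\<close> unfolding l_def by simp
    then have "(1 - l) * u + l * v = z" by (simp add: algebra_simps)
    then show ?thesis
      using normal_density_le_chord[OF \<open>\<tau> > 0\<close> l, of u v] unfolding h_def \<alpha>_def \<beta>_def C_def l1 by (simp add: l_def algebra_simps)
  qed
  have "normal_tail \<tau> u - normal_tail \<tau> v = N.prob ({u..} - {v..})"
    unfolding normal_tail_def using \<open>u < v\<close> by (intro N.finite_measure_Diff[symmetric]) auto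
  also have "\<dots> \<le> N.prob {u..v}" by (intro N.finite_measure_mono) auto
  finally have 1: "normal_tail \<tau> u - normal_tail \<tau> v \<le> N.prob {u..v}" .
  have "emeasure (density lborel ?\<phi>) {u..v} = (\<integral>\<^sup>+z. ennreal (?\<phi> z) * indicator {u..v} z \<partial>lborel)"
    by (simp add: emeasure_density)
  also have "\<dots> \<le> (\<integral>\<^sup>+z. ennreal (h z) * indicator {u..v} z \<partial>lborel)"
    using le by (intro nn_integral_mono) (auto split: split_indicator intro: ennreal_leI)
  also have "\<dots> = ennreal (H v - H u)"
  proof (rule nn_integral_FTC_Icc)
    show "(H has_real_derivative h z) (at z)" if "z \<in> {u..v}" for z
      unfolding H_def h_def
      by (auto intro!: derivative_eq_intros simp: field_simps)
    show "h \<in> borel_measurable borel" unfolding h_def by measurable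
  qed (use h0 \<open>u < v\<close> in auto)
  also have "H v - H u = (v - u) * C * ((?\<phi> u + ?\<phi> v) / 2)"
  proof -
    have "\<alpha> * (v - u) = C * ?\<phi> u" "\<beta> * (v - u) = C * ?\<phi> v"
      unfolding \<alpha>_def \<beta>_def using \<open>u < v\<close> by auto
    moreover have "H v - H u = (v - u) * ((\<alpha> * (v - u) + \<beta> * (v - u)) / 2)"
    proof -
      define w where "w = v - u"
      have "H v = \<beta> * w\<^sup>2 / 2" "H u = - \<alpha> * w\<^sup>2 / 2" unfolding H_def w_def by simp_all
      then show ?thesis unfolding w_def[symmetric] by (simp add: power2_eq_square algebra_simps)
    qed
    ultimately show ?thesis by (simp add: algebra_simps)
  qed
  finally have "N.prob {u..v} \<le> (v - u) * C * ((?\<phi> u + ?\<phi> v) / 2)"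
    using \<open>u < v\<close> \<open>C > 0\<close> by (simp add: N.emeasure_eq_measure)
  then show ?thesis using 1 unfolding C_def by simp
qed

text \<open>Minus \<open>\<tau>\<close> times the density is an antiderivative of \<open>z\<close>
  times the density, which evaluates the first moment beyond \<open>t\<close>; subtracting
  \<open>t\<close> times the tail gives the mean excess over \<open>t\<close>. Nonnegativity is
  stated separately because \<open>ennreal\<close> sends negative numbers to 0.\<close>

lemma normal_excess:
  assumes "\<tau> > 0"
  shows "(\<integral>\<^sup>+z. ennreal (max (z - t) 0) * ennreal (normal_density 0 (sqrt \<tau>) z) \<partial>lborel)
     = ennreal (\<tau> * normal_density 0 (sqrt \<tau>) t - t * normal_tail \<tau> t)"
    and "0 \<le> \<tau> * normal_density 0 (sqrt \<tau>) t - t * normal_tail \<tau> t"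
proof -
  let ?\<phi> = "normal_density 0 (sqrt \<tau>)"
  have st: "sqrt \<tau> > 0" using assms by simp
  interpret N: prob_space "density lborel ?\<phi>"
    using st by (intro prob_space_normal_density) auto
  have int: "integrable lborel ?\<phi>" "integrable lborel (\<lambda>z. ?\<phi> z * z)"
    using integrable_normal_density[OF st] integrable_normal_moment_nz_1[OF st] by auto
  have int1: "integrable lborel (\<lambda>z. indicator {t<..} z * ?\<phi> z)"
    and int2: "integrable lborel (\<lambda>z. indicator {t<..} z * (?\<phi> z * z))"
    using integrable_mult_indicator[OF _ int(1), of "{t<..}"]
      integrable_mult_indicator[OF _ int(2), of "{t<..}"] by simp_all
  \<comment> \<open>The tail is defined with the closed half-line, the improper integral below lives
    on the open one; they differ by a null set.\<close>
  have tail: "(\<integral>z. indicator {t<..} z * ?\<phi> z \<partial>lborel) = normal_tail \<tau> t"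
  proof -
    have "emeasure (density lborel ?\<phi>) {t..} = (\<integral>\<^sup>+z. ennreal (indicator {t<..} z * ?\<phi> z) \<partial>lborel)"
      using AE_lborel_singleton[of t]
      by (subst emeasure_density)
        (auto intro!: nn_integral_cong_AE elim!: eventually_mono split: split_indicator)
    also have "\<dots> = ennreal (\<integral>z. indicator {t<..} z * ?\<phi> z \<partial>lborel)"
      using int1 by (intro nn_integral_eq_integral) auto
    finally show ?thesis
      unfolding normal_tail_def by (simp add: N.emeasure_eq_measure)
  qed
  have der: "((\<lambda>z. - \<tau> * ?\<phi> z) has_real_derivative ?\<phi> z * z) (at z)" for z
    unfolding normal_density_def using assms
    by (auto intro!: derivative_eq_intros simp: field_simps)
  have lim: "((\<lambda>z. - \<tau> * ?\<phi> z) \<longlongrightarrow> 0) at_top"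
    unfolding normal_density_def using assms by real_asymp
  have seg: "(LBINT z=ereal t..\<infinity>. ?\<phi> z * z) = 0 - (- \<tau> * ?\<phi> t)"
  proof (rule interval_integral_FTC_integrable)
    show "set_integrable lborel (einterval (ereal t) \<infinity>) (\<lambda>z. ?\<phi> z * z)"
      unfolding set_integrable_def using integrable_mult_indicator[OF _ int(2)] by simp
    show "((\<lambda>z. - \<tau> * ?\<phi> z) has_vector_derivative ?\<phi> z * z) (at z)" for z
      using der by (simp add: has_real_derivative_iff_has_vector_derivative)
    show "isCont (\<lambda>z. ?\<phi> z * z) z" for z
      unfolding normal_density_def using assms by (intro continuous_intros) auto
    show "(((\<lambda>z. - \<tau> * ?\<phi> z) \<circ> real_of_ereal) \<longlongrightarrow> - \<tau> * ?\<phi> t) (at_right (ereal t))"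
      unfolding ereal_tendsto_simps
      using DERIV_isCont[OF der[of t]] unfolding isCont_def
      by (rule tendsto_mono[rotated]) (simp add: at_le)
    show "(((\<lambda>z. - \<tau> * ?\<phi> z) \<circ> real_of_ereal) \<longlongrightarrow> 0) (at_left \<infinity>)"
      using lim unfolding ereal_tendsto_simps .
  qed auto
  have mom: "(\<integral>z. indicator {t<..} z * (?\<phi> z * z) \<partial>lborel) = \<tau> * ?\<phi> t"
    using seg unfolding interval_integral_to_infinity_eq set_lebesgue_integral_def by simp
  have eq: "(\<lambda>z. max (z - t) 0 * ?\<phi> z)
      = (\<lambda>z. indicator {t<..} z * (?\<phi> z * z) - t * (indicator {t<..} z * ?\<phi> z))"
    by (auto simp: algebra_simps max_def split: split_indicator)
  have intm: "integrable lborel (\<lambda>z. max (z - t) 0 * ?\<phi> z)"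
    unfolding eq using int1 int2 by auto
  have val: "(\<integral>z. max (z - t) 0 * ?\<phi> z \<partial>lborel) = \<tau> * ?\<phi> t - t * normal_tail \<tau> t"
    unfolding eq using int1 int2 mom tail by simp
  show "0 \<le> \<tau> * ?\<phi> t - t * normal_tail \<tau> t"
    unfolding val[symmetric] by (intro integral_nonneg_AE) auto
  show "(\<integral>\<^sup>+z. ennreal (max (z - t) 0) * ennreal (?\<phi> z) \<partial>lborel) = ennreal (\<tau> * ?\<phi> t - t * normal_tail \<tau> t)"
    unfolding val[symmetric] using intm
    by (subst nn_integral_eq_integral[symmetric]) (auto simp: ennreal_mult)
qed

section \<open>Finite-valued variables and independent sums\<close>

text \<open>Almost surely \<open>H (X \<omega>)\<close> is a sum of constants over the events that
  \<open>X\<close> equals \<open>x i\<close>; injectivity of \<open>x\<close> ensures that exactly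
  one of them occurs.\<close>

lemma (in prob_space) nn_integral_finite_range:
  fixes X :: "'a \<Rightarrow> real" and H :: "real \<Rightarrow> ennreal"
  assumes [measurable]: "X \<in> borel_measurable M" and "finite I" "inj_on x I"
    and range: "AE \<omega> in M. X \<omega> \<in> x ` I"
    and p: "\<And>i. i \<in> I \<Longrightarrow> prob {\<omega> \<in> space M. X \<omega> = x i} = p i"
  shows "(\<integral>\<^sup>+\<omega>. H (X \<omega>) \<partial>M) = (\<Sum>i\<in>I. ennreal (p i) * H (x i))"
proof -
  let ?A = "\<lambda>i. {\<omega> \<in> space M. X \<omega> = x i}"
  have "(\<integral>\<^sup>+\<omega>. H (X \<omega>) \<partial>M) = (\<integral>\<^sup>+\<omega>. (\<Sum>i\<in>I. H (x i) * indicator (?A i) \<omega>) \<partial>M)"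
  proof (rule nn_integral_cong_AE)
    show "AE \<omega> in M. H (X \<omega>) = (\<Sum>i\<in>I. H (x i) * indicator (?A i) \<omega>)"
      using range AE_space
    proof eventually_elim
      case (elim \<omega>)
      then obtain k where k: "k \<in> I" "X \<omega> = x k" by auto
      have "\<omega> \<in> ?A i \<longleftrightarrow> i = k" if "i \<in> I" for i
        using inj_on_eq_iff[OF \<open>inj_on x I\<close> that k(1)] elim(2) k(2) by auto
      then have "(\<Sum>i\<in>I. H (x i) * indicator (?A i) \<omega>) = (\<Sum>i\<in>I. if i = k then H (x k) else 0)"
        by (intro sum.cong refl) (simp add: indicator_def)
      then show ?case using k \<open>finite I\<close> by simp
    qed
  qed
  also have "\<dots> = (\<Sum>i\<in>I. H (x i) * emeasure M (?A i))"
    by (subst nn_integral_sum) (simp_all add: nn_integral_cmult_indicator)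
  also have "\<dots> = (\<Sum>i\<in>I. ennreal (p i) * H (x i))"
    using p by (intro sum.cong refl) (simp add: emeasure_eq_measure mult.commute)
  finally show ?thesis .
qed

text \<open>The same decomposition for real integrands. \<open>has_bochner_integral\<close> delivers
  integrability together with the value.\<close>

lemma (in prob_space) has_bochner_integral_finite_range:
  fixes X :: "'a \<Rightarrow> real" and H :: "real \<Rightarrow> real"
  assumes [measurable]: "X \<in> borel_measurable M" "H \<in> borel_measurable borel"
    and "finite I" "inj_on x I"
    and range: "AE \<omega> in M. X \<omega> \<in> x ` I"
    and p: "\<And>i. i \<in> I \<Longrightarrow> prob {\<omega> \<in> space M. X \<omega> = x i} = p i"
  shows "has_bochner_integral M (\<lambda>\<omega>. H (X \<omega>)) (\<Sum>i\<in>I. p i * H (x i))"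
proof -
  let ?A = "\<lambda>i. {\<omega> \<in> space M. X \<omega> = x i}"
  have "has_bochner_integral M (\<lambda>\<omega>. \<Sum>i\<in>I. indicator (?A i) \<omega> * H (x i)) (\<Sum>i\<in>I. prob (?A i) * H (x i))"
    by (intro has_bochner_integral_sum has_bochner_integral_mult_left has_bochner_integral_real_indicator)
      (simp_all add: emeasure_eq_measure)
  also have "(\<Sum>i\<in>I. prob (?A i) * H (x i)) = (\<Sum>i\<in>I. p i * H (x i))"
    using p by simp
  finally have "has_bochner_integral M (\<lambda>\<omega>. \<Sum>i\<in>I. indicator (?A i) \<omega> * H (x i)) (\<Sum>i\<in>I. p i * H (x i))" .
  moreover have ae: "AE \<omega> in M. (\<Sum>i\<in>I. indicator (?A i) \<omega> * H (x i)) = H (X \<omega>)"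
    using range AE_space
  proof eventually_elim
    case (elim \<omega>)
    then obtain k where k: "k \<in> I" "X \<omega> = x k" by auto
    have "\<omega> \<in> ?A i \<longleftrightarrow> i = k" if "i \<in> I" for i
      using inj_on_eq_iff[OF \<open>inj_on x I\<close> that k(1)] elim(2) k(2) by auto
    then have "(\<Sum>i\<in>I. indicator (?A i) \<omega> * H (x i)) = (\<Sum>i\<in>I. if i = k then H (x k) else 0)"
      by (intro sum.cong refl) (simp add: indicator_def)
    then show ?case using k \<open>finite I\<close> by simp
  qed
  moreover have m: "(\<lambda>\<omega>. \<Sum>i\<in>I. indicator (?A i) \<omega> * H (x i)) \<in> borel_measurable M"
    "(\<lambda>\<omega>. H (X \<omega>)) \<in> borel_measurable M"
    by measurable
  ultimately show ?thesis
    using has_bochner_integral_cong_AE[OF m ae] by simp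
qed

text \<open>Under independence the joint law is the product law; Tonelli integrates over
  \<open>Z\<close> first, through its density.\<close>

lemma (in prob_space) nn_integral_indep_sum:
  fixes X Z :: "'a \<Rightarrow> real" and h :: "real \<Rightarrow> ennreal"
  assumes indep: "indep_var borel X borel Z" and Z: "distributed M lborel Z f"
    and [measurable]: "h \<in> borel_measurable borel"
  shows "(\<integral>\<^sup>+\<omega>. h (X \<omega> + Z \<omega>) \<partial>M) = (\<integral>\<^sup>+\<omega>. (\<integral>\<^sup>+z. f z * h (X \<omega> + z) \<partial>lborel) \<partial>M)"
proof -
  have [measurable]: "X \<in> borel_measurable M"
    using indep by (rule indep_var_rv1)
  have [measurable]: "Z \<in> borel_measurable M"
    using indep by (rule indep_var_rv2)
  have eq: "distr M borel X \<Otimes>\<^sub>M distr M borel Z = distr M (borel \<Otimes>\<^sub>M borel) (\<lambda>\<omega>. (X \<omega>, Z \<omega>))"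
    using indep unfolding indep_var_distribution_eq by simp
  interpret Z: prob_space "distr M borel Z" by (rule prob_space_distr) measurable
  have "(\<integral>\<^sup>+\<omega>. h (X \<omega> + Z \<omega>) \<partial>M) = (\<integral>\<^sup>+q. h (fst q + snd q) \<partial>distr M (borel \<Otimes>\<^sub>M borel) (\<lambda>\<omega>. (X \<omega>, Z \<omega>)))"
  proof -
    have "(\<lambda>\<omega>. (X \<omega>, Z \<omega>)) \<in> M \<rightarrow>\<^sub>M borel \<Otimes>\<^sub>M borel" by measurable
    moreover have "(\<lambda>q. h (fst q + snd q)) \<in> borel_measurable (borel \<Otimes>\<^sub>M borel)" by measurable
    ultimately show ?thesis by (simp add: nn_integral_distr)
  qed
  also have "\<dots> = (\<integral>\<^sup>+a. \<integral>\<^sup>+z. h (a + z) \<partial>distr M borel Z \<partial>distr M borel X)"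
  proof -
    have "(\<lambda>q. h (fst q + snd q)) \<in> borel_measurable (distr M borel X \<Otimes>\<^sub>M distr M borel Z)"
      by measurable
    from Z.nn_integral_fst[OF this] show ?thesis unfolding eq[symmetric] by simp
  qed
  also have "\<dots> = (\<integral>\<^sup>+\<omega>. \<integral>\<^sup>+z. h (X \<omega> + z) \<partial>distr M borel Z \<partial>M)"
    by (rule nn_integral_distr) measurable
  also have "\<dots> = (\<integral>\<^sup>+\<omega>. \<integral>\<^sup>+z. f z * h (X \<omega> + z) \<partial>lborel \<partial>M)"
  proof (rule nn_integral_cong)
    fix \<omega>
    have "(\<integral>\<^sup>+z. h (X \<omega> + z) \<partial>distr M borel Z) = (\<integral>\<^sup>+\<omega>'. h (X \<omega> + Z \<omega>') \<partial>M)"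
      by (rule nn_integral_distr) measurable
    also have "\<dots> = (\<integral>\<^sup>+z. f z * h (X \<omega> + z) \<partial>lborel)"
      by (rule distributed_nn_integral[OF Z, symmetric]) measurable
    finally show "(\<integral>\<^sup>+z. h (X \<omega> + z) \<partial>distr M borel Z) = (\<integral>\<^sup>+z. f z * h (X \<omega> + z) \<partial>lborel)" .
  qed
  finally show ?thesis .
qed

text \<open>The larger of two points \<open>x i\<close>, \<open>x j\<close> has the smaller argument
  \<open>s - x i\<close> or \<open>s - x j\<close>, so the trapezoidal bound applies after ordering
  the pair; both sides are symmetric in \<open>i\<close> and \<open>j\<close>.\<close>

lemma weighted_normal_tail_bound:
  fixes p x :: "'i \<Rightarrow> real"
  assumes I: "finite I" and p: "\<And>i. i \<in> I \<Longrightarrow> m \<le> p i" "m > 0" "(\<Sum>i\<in>I. p i) = 1"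
    and \<mu>: "\<mu> = (\<Sum>i\<in>I. p i * x i)" and v: "v = (\<Sum>i\<in>I. p i * (x i - \<mu>)\<^sup>2)"
    and "\<tau> > 0"
  shows "(\<Sum>i\<in>I. p i * (x i - \<mu>) * normal_tail \<tau> (s - x i))
    \<le> v / m * exp (v / (\<tau> * m)) * (\<Sum>i\<in>I. p i * normal_density 0 (sqrt \<tau>) (s - x i))"
proof (rule weighted_tail_bound[OF I p \<mu> v \<open>\<tau> > 0\<close>])
  let ?\<phi> = "\<lambda>i. normal_density 0 (sqrt \<tau>) (s - x i)" and ?Q = "\<lambda>i. normal_tail \<tau> (s - x i)"
  have less: "(x i - x j) * (?Q i - ?Q j) \<le> (x i - x j)\<^sup>2 * exp ((x i - x j)\<^sup>2 / (8 * \<tau>)) * ((?\<phi> i + ?\<phi> j) / 2)"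
    if "x j < x i" for i j
  proof -
    have "?Q i - ?Q j \<le> (x i - x j) * exp ((x i - x j)\<^sup>2 / (8 * \<tau>)) * ((?\<phi> i + ?\<phi> j) / 2)"
      using normal_tail_diff_le[OF \<open>\<tau> > 0\<close>, of "s - x i" "s - x j"] that by simp
    then have "(x i - x j) * (?Q i - ?Q j)
        \<le> (x i - x j) * ((x i - x j) * exp ((x i - x j)\<^sup>2 / (8 * \<tau>)) * ((?\<phi> i + ?\<phi> j) / 2))"
      using that by (intro mult_left_mono) auto
    then show ?thesis by (simp add: power2_eq_square mult.assoc)
  qed
  fix i j
  consider "x i = x j" | "x j < x i" | "x i < x j" by linarith
  then show "(x i - x j) * (?Q i - ?Q j) \<le> (x i - x j)\<^sup>2 * exp ((x i - x j)\<^sup>2 / (8 * \<tau>)) * ((?\<phi> i + ?\<phi> j) / 2)"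
  proof cases
    case 3
    have "(x i - x j) * (?Q i - ?Q j) = (x j - x i) * (?Q j - ?Q i)" by (simp add: algebra_simps)
    then show ?thesis using less[OF 3] by (simp add: power2_commute add.commute)
  next
    case 1
    then show ?thesis by simp
  next
    case 2
    then show ?thesis by (rule less)
  qed
qed simp_all

text \<open>The kernel criterion is applied with the mixture density \<open>f\<close>. The normal
  part contributes \<open>\<tau> * f\<close> to the kernel, and the weighted tails add at most
  \<open>\<tau> * K * exp K * f\<close> with
  \<open>K = \<sigma>\<^sup>2 / (\<tau> * m)\<close>.\<close>

theorem theorem1p4:
  fixes M :: "'a measure" and X Z :: "'a \<Rightarrow> real"
    and n :: nat and x p :: "nat \<Rightarrow> real" and \<sigma> \<tau> :: real
  assumes "prob_space M"
    and "X \<in> borel_measurable M"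
    and "inj_on x {1..n}"
    and "AE \<omega> in M. X \<omega> \<in> x ` {1..n}"
    and "\<And>i. i \<in> {1..n} \<Longrightarrow> measure M {\<omega> \<in> space M. X \<omega> = x i} = p i"
    and "\<And>i. i \<in> {1..n} \<Longrightarrow> p i > 0"
    and "prob_space.variance M X = \<sigma>\<^sup>2"
    and "\<tau> > 0"
    and "distributed M lborel Z (normal_density 0 (sqrt \<tau>))"
    and "prob_space.indep_var M borel X borel Z"
  shows "poincare_constant M (\<lambda>\<omega>. X \<omega> + Z \<omega>) \<le>
    ennreal (\<tau> * (1 + (\<sigma>\<^sup>2 / (\<tau> * Min (p ` {1..n}))) * exp (\<sigma>\<^sup>2 / (\<tau> * Min (p ` {1..n})))))"
proof -
  interpret prob_space M by fact
  let ?\<phi> = "normal_density 0 (sqrt \<tau>)"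
  define I where "I = {1..n}"
  define m where "m = Min (p ` I)"
  define \<mu> where "\<mu> = (\<Sum>i\<in>I. p i * x i)"
  define f where "f s = (\<Sum>i\<in>I. p i * ?\<phi> (s - x i))" for s
  define Y where "Y \<omega> = X \<omega> + Z \<omega>" for \<omega>
  have st: "sqrt \<tau> > 0" using \<open>\<tau> > 0\<close> by simp
  note X [measurable] = \<open>X \<in> borel_measurable M\<close>
  have [measurable]: "Z \<in> borel_measurable M"
    using assms(10) by (rule indep_var_rv2)
  have Ym [measurable]: "Y \<in> borel_measurable M" unfolding Y_def by measurable
  have fm [measurable]: "f \<in> borel_measurable borel" unfolding f_def by measurable
  have fin: "finite I" and inj: "inj_on x I" and range: "AE \<omega> in M. X \<omega> \<in> x ` I"
    and p: "\<And>i. i \<in> I \<Longrightarrow> prob {\<omega> \<in> space M. X \<omega> = x i} = p i"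
    and p0: "\<And>i. i \<in> I \<Longrightarrow> 0 < p i"
    using assms unfolding I_def by auto
  have discrete: "has_bochner_integral M (\<lambda>\<omega>. H (X \<omega>)) (\<Sum>i\<in>I. p i * H (x i))"
    if "H \<in> borel_measurable borel" for H :: "real \<Rightarrow> real"
    using X that fin inj range p by (rule has_bochner_integral_finite_range)
  \<comment> \<open>Taking for \<open>H\<close> the constant 1, the identity and the squared
    deviation expresses total mass, mean and variance through \<open>p\<close> and
    \<open>x\<close>.\<close>
  have p1: "(\<Sum>i\<in>I. p i) = 1"
    using has_bochner_integral_integral_eq[OF discrete[of "\<lambda>_. 1"]] by (simp add: prob_space)
  have X\<mu>: "has_bochner_integral M X \<mu>"
    using discrete[of "\<lambda>a. a"] unfolding \<mu>_def by simp
  have var: "\<sigma>\<^sup>2 = (\<Sum>i\<in>I. p i * (x i - \<mu>)\<^sup>2)"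
    using has_bochner_integral_integral_eq[OF discrete[of "\<lambda>a. (a - \<mu>)\<^sup>2"]]
      has_bochner_integral_integral_eq[OF X\<mu>] assms(7) by simp
  \<comment> \<open>The case \<open>n = 0\<close> is excluded because an empty sum of weights is not
    1; this makes \<open>Min\<close> meaningful.\<close>
  have "I \<noteq> {}" using p1 by auto
  have m: "m > 0" "\<And>i. i \<in> I \<Longrightarrow> m \<le> p i"
    unfolding m_def using fin p0 \<open>I \<noteq> {}\<close> by simp_all
  have law: "(\<integral>\<^sup>+\<omega>. h (Y \<omega>) \<partial>M) = (\<Sum>i\<in>I. ennreal (p i) * (\<integral>\<^sup>+z. ennreal (?\<phi> z) * h (x i + z) \<partial>lborel))"
    if [measurable]: "h \<in> borel_measurable borel" for h :: "real \<Rightarrow> ennreal"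
    unfolding Y_def nn_integral_indep_sum[OF assms(10,9) that]
    by (rule nn_integral_finite_range[OF X fin inj range p])
  have law_density: "(\<integral>\<^sup>+\<omega>. h (Y \<omega>) \<partial>M) = (\<integral>\<^sup>+s. ennreal (f s) * h s \<partial>lborel)"
    if [measurable]: "h \<in> borel_measurable borel" for h :: "real \<Rightarrow> ennreal"
  proof -
    \<comment> \<open>Substitution \<open>s = x i + z\<close>, under which Lebesgue measure is
      invariant.\<close>
    have "(\<integral>\<^sup>+z. ennreal (?\<phi> z) * h (x i + z) \<partial>lborel) = (\<integral>\<^sup>+s. ennreal (?\<phi> (s - x i)) * h s \<partial>lborel)" for i
      by (subst nn_integral_real_affine[where c = 1 and t = "x i" and f = "\<lambda>s. ennreal (?\<phi> (s - x i)) * h s"])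
        simp_all
    then have "(\<integral>\<^sup>+\<omega>. h (Y \<omega>) \<partial>M) = (\<Sum>i\<in>I. ennreal (p i) * (\<integral>\<^sup>+s. ennreal (?\<phi> (s - x i)) * h s \<partial>lborel))"
      unfolding law[OF that] by simp
    also have "\<dots> = (\<integral>\<^sup>+s. (\<Sum>i\<in>I. ennreal (p i) * (ennreal (?\<phi> (s - x i)) * h s)) \<partial>lborel)"
      by (subst nn_integral_sum) (auto simp: nn_integral_cmult)
    also have "\<dots> = (\<integral>\<^sup>+s. ennreal (f s) * h s \<partial>lborel)"
    proof (rule nn_integral_cong)
      fix s
      have "ennreal (f s) = (\<Sum>i\<in>I. ennreal (p i) * ennreal (?\<phi> (s - x i)))"
        unfolding f_def using p0 by (simp add: sum_ennreal[symmetric] ennreal_mult less_imp_le)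
      then show "(\<Sum>i\<in>I. ennreal (p i) * (ennreal (?\<phi> (s - x i)) * h s)) = ennreal (f s) * h s"
        by (simp add: sum_distrib_right mult.assoc)
    qed
    finally show ?thesis .
  qed
  have distY: "distributed M lborel Y f"
    unfolding distributed_def
  proof (intro conjI)
    show "distr M lborel Y = density lborel (\<lambda>s. ennreal (f s))"
    proof (rule measure_eqI)
      fix A assume "A \<in> sets (distr M lborel Y)"
      then have [measurable]: "A \<in> sets borel" by simp
      have "emeasure (distr M lborel Y) A = (\<integral>\<^sup>+\<omega>. indicator A (Y \<omega>) \<partial>M)"
      proof -
        have "emeasure (distr M lborel Y) A = (\<integral>\<^sup>+y. indicator A y \<partial>distr M lborel Y)" by simp
        also have "\<dots> = (\<integral>\<^sup>+\<omega>. indicator A (Y \<omega>) \<partial>M)" by (rule nn_integral_distr) measurable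
        finally show ?thesis .
      qed
      also have "\<dots> = emeasure (density lborel (\<lambda>s. ennreal (f s))) A"
        by (subst law_density) (auto simp: emeasure_density)
      finally show "emeasure (distr M lborel Y) A = emeasure (density lborel (\<lambda>s. ennreal (f s))) A" .
    qed simp
  qed simp_all
  have intZ: "integrable M Z" "expectation Z = 0"
  proof -
    have "integrable lborel (\<lambda>z. ?\<phi> z * z)"
      using integrable_normal_moment_nz_1[OF st] by simp
    then show "integrable M Z"
      using distributed_integrable[OF assms(9), of "\<lambda>z. z"] by simp
    show "expectation Z = 0"
      using normal_distributed_expectation[OF st assms(9)] .
  qed
  have intY: "integrable M Y" and EY: "expectation Y = \<mu>"
    unfolding Y_def using X\<mu> intZ by (auto simp: has_bochner_integral_iff)
  have tail: "prob {\<omega> \<in> space M. s \<le> Y \<omega>} = (\<Sum>i\<in>I. p i * normal_tail \<tau> (s - x i))" for s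
  proof -
    interpret N: prob_space "density lborel ?\<phi>" using st by (rule prob_space_normal_density)
    have "emeasure M {\<omega> \<in> space M. s \<le> Y \<omega>} = (\<integral>\<^sup>+\<omega>. indicator {s..} (Y \<omega>) \<partial>M)"
    proof -
      have "(\<integral>\<^sup>+\<omega>. indicator {s..} (Y \<omega>) \<partial>M) = (\<integral>\<^sup>+\<omega>. indicator {\<omega> \<in> space M. s \<le> Y \<omega>} \<omega> \<partial>M)"
        by (intro nn_integral_cong) (auto split: split_indicator)
      then show ?thesis by simp
    qed
    also have "\<dots> = (\<Sum>i\<in>I. ennreal (p i) * (\<integral>\<^sup>+z. ennreal (?\<phi> z) * indicator {s..} (x i + z) \<partial>lborel))"
      by (rule law) simp
    also have "\<dots> = (\<Sum>i\<in>I. ennreal (p i * normal_tail \<tau> (s - x i)))"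
    proof (rule sum.cong[OF refl])
      fix i assume "i \<in> I"
      have "(\<integral>\<^sup>+z. ennreal (?\<phi> z) * indicator {s..} (x i + z) \<partial>lborel) = emeasure (density lborel ?\<phi>) {s - x i..}"
        by (subst emeasure_density) (auto intro!: nn_integral_cong split: split_indicator)
      then show "ennreal (p i) * (\<integral>\<^sup>+z. ennreal (?\<phi> z) * indicator {s..} (x i + z) \<partial>lborel)
          = ennreal (p i * normal_tail \<tau> (s - x i))"
        using p0[OF \<open>i \<in> I\<close>] by (simp add: N.emeasure_eq_measure normal_tail_def ennreal_mult')
    qed
    finally show ?thesis
      using p0 by (subst (asm) sum_ennreal)
        (auto simp: emeasure_eq_measure normal_tail_def sum_nonneg less_imp_le)
  qed
  have excess: "expectation (\<lambda>\<omega>. max (Y \<omega> - s) 0)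
      = (\<Sum>i\<in>I. p i * (\<tau> * ?\<phi> (s - x i) - (s - x i) * normal_tail \<tau> (s - x i)))" for s
  proof -
    let ?e = "\<lambda>i. \<tau> * ?\<phi> (s - x i) - (s - x i) * normal_tail \<tau> (s - x i)"
    have e0: "0 \<le> ?e i" for i using normal_excess(2)[OF \<open>\<tau> > 0\<close>] .
    have "ennreal (expectation (\<lambda>\<omega>. max (Y \<omega> - s) 0)) = (\<integral>\<^sup>+\<omega>. ennreal (max (Y \<omega> - s) 0) \<partial>M)"
      using intY by (intro nn_integral_eq_integral[symmetric]) auto
    also have "\<dots> = (\<Sum>i\<in>I. ennreal (p i) * (\<integral>\<^sup>+z. ennreal (?\<phi> z) * ennreal (max (x i + z - s) 0) \<partial>lborel))"
      by (rule law) measurable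
    also have "\<dots> = (\<Sum>i\<in>I. ennreal (p i * ?e i))"
    proof (rule sum.cong[OF refl])
      fix i assume "i \<in> I"
      have "(\<integral>\<^sup>+z. ennreal (?\<phi> z) * ennreal (max (x i + z - s) 0) \<partial>lborel)
          = (\<integral>\<^sup>+z. ennreal (max (z - (s - x i)) 0) * ennreal (?\<phi> z) \<partial>lborel)"
        by (intro nn_integral_cong) (simp add: mult.commute algebra_simps)
      also have "\<dots> = ennreal (?e i)" by (rule normal_excess(1)[OF \<open>\<tau> > 0\<close>])
      finally show "ennreal (p i) * (\<integral>\<^sup>+z. ennreal (?\<phi> z) * ennreal (max (x i + z - s) 0) \<partial>lborel)
          = ennreal (p i * ?e i)"
        using p0[OF \<open>i \<in> I\<close>] by (simp add: ennreal_mult')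
    qed
    also have "\<dots> = ennreal (\<Sum>i\<in>I. p i * ?e i)"
      using p0 e0 by (intro sum_ennreal) (simp add: less_imp_le)
    finally show ?thesis
      using p0 e0 by (simp add: sum_nonneg less_imp_le)
  qed
  define K where "K = \<sigma>\<^sup>2 / (\<tau> * m)"
  have "K \<ge> 0" unfolding K_def using m \<open>\<tau> > 0\<close> by simp
  have "poincare_constant M Y \<le> ennreal (\<tau> * (1 + K * exp K))"
  proof (rule poincare_constant_le[OF distY intY])
    show "0 \<le> \<tau> * (1 + K * exp K)" using \<open>K \<ge> 0\<close> \<open>\<tau> > 0\<close> by simp
    fix s
    have "expectation (\<lambda>\<omega>. max (Y \<omega> - s) 0) + prob {\<omega> \<in> space M. s \<le> Y \<omega>} * (s - expectation Y)
        = (\<Sum>i\<in>I. p i * (\<tau> * ?\<phi> (s - x i) - (s - x i) * normal_tail \<tau> (s - x i))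
          + p i * normal_tail \<tau> (s - x i) * (s - \<mu>))"
      unfolding excess tail EY by (simp add: sum.distrib sum_distrib_right)
    \<comment> \<open>The tail terms combine through
      \<open>(s - \<mu>) - (s - x i) = x i - \<mu>\<close>.\<close>
    also have "\<dots> = (\<Sum>i\<in>I. \<tau> * (p i * ?\<phi> (s - x i)) + p i * (x i - \<mu>) * normal_tail \<tau> (s - x i))"
      by (intro sum.cong refl) (simp add: algebra_simps)
    also have "\<dots> = \<tau> * f s + (\<Sum>i\<in>I. p i * (x i - \<mu>) * normal_tail \<tau> (s - x i))"
      unfolding f_def by (simp add: sum.distrib sum_distrib_left)
    also have "\<dots> \<le> \<tau> * f s + \<sigma>\<^sup>2 / m * exp (\<sigma>\<^sup>2 / (\<tau> * m)) * f s"
      using weighted_normal_tail_bound[OF fin m(2,1) p1 \<mu>_def var \<open>\<tau> > 0\<close>] unfolding f_def by simp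
    \<comment> \<open>Here \<open>\<sigma>\<^sup>2 / m = \<tau> * K\<close>.\<close>
    also have "\<dots> = \<tau> * (1 + K * exp K) * f s"
      unfolding K_def using \<open>\<tau> > 0\<close> m(1) by (simp add: field_simps)
    finally show "expectation (\<lambda>\<omega>. max (Y \<omega> - s) 0) + prob {\<omega> \<in> space M. s \<le> Y \<omega>} * (s - expectation Y)
        \<le> \<tau> * (1 + K * exp K) * f s" .
  qed
  then show ?thesis unfolding Y_def K_def m_def I_def by simp
qed

end
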